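(* Let $G$ be a finite simple graph with edge ideal $I=I(G)\subseteq R=\Bbbk[x_1,\dots,x_n]$ minimally generated by its edges $f_1,\dots,f_r$. Let $J$ be the defining ideal of the Rees algebra $R[It]$, let $\phi$ be the presentation matrix of $I$ from its Taylor resolution, let $\overline{B(\phi)}$ be its reduced Jacobian dual, let $\mathbf T=[T_1\ \cdots\ T_r]$, and let $k=\operatorname{rank}\overline{B(\phi)}$. Then $$J=\big\langle \mathbf T\cdot\phi,\ \operatorname{bi}(I_2(\overline{B(\phi)})),\ \operatorname{bi}(I_3(\overline{B(\phi)})),\ \dots,\ \operatorname{bi}(I_k(\overline{B(\phi)}))\big\rangle ,$$ where $\mathbf T\cdot\phi$ stands for the entries of that row vector and, for a matrix $M$, $\operatorname{bi}(I_t(M))$ denotes the collection of $t\times t$ minors of $M$ that are binomials.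
   Context: $\Bbbk$ is an infinite field, $R=\Bbbk[x_1,\dots,x_n]$, $\mathfrak m=(x_1,\dots,x_n)$. $G$ is a finite simple undirected graph whose vertices are identified with the variables $x_1,\dots,x_n$; an edge between $x_i$ and $x_j$ is identified with the monomial $x_ix_j$. The edge ideal is $I(G)=\langle x_ix_j : x_ix_j \text{ is an edge of } G\rangle$. The Rees algebra is $R[It]=R\oplus It\oplus I^2t^2\oplus\cdots\subseteq R[t]$. Its defining ideal is $J=\ker\theta$, where $\theta:R[T_1,\dots,T_r]\to R[It]$ is the $R$-algebra map with $\theta(T_i)=f_it$. Taylor presentation matrix: $\phi$ has rows indexed by $f_1,\dots,f_r$ and columns indexed by the 2-element subsets $\tau$ of $\{f_1,\dots,f_r\}$; the column of $\tau=\{f_j,f_k\}$, $j<k$, has entry $-\operatorname{lcm}(f_j,f_k)/f_j$ in row $f_j$, entry $\operatorname{lcm}(f_j,f_k)/f_k$ in row $f_k$, and $0$ elsewhere. Jacobian dual: $B(\phi)$ is a matrix with entries in $R[T_1,\dots,T_r]$, linear in $T_1,\dots,T_r$, with $[T_1\ \cdots\ T_r]\cdot\phi=[x_1\ \cdots\ x_n]\cdot B(\phi)$. The reduced Jacobian dual $\overline{B(\phi)}=B(\phi)\otimes R/\mathfrak m$ is obtained by reducing the entries modulo $x_1,\dots,x_n$; it does not depend on the choice of $B(\phi)$. A $t\times t$ minor is the determinant of a $t\times t$ submatrix; it is binomial if it can be written as the sum or difference of two monomials. $I_t(M)$ denotes the ideal generated by all $t\times t$ minors of $M$. *)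

theory Defs
  imports
    "HOL-Library.Poly_Mapping"
    "HOL-Computational_Algebra.Polynomial"
    "HOL-Computational_Algebra.Fraction_Field"
    "HOL-Algebra.Ideal_Product"
    "Jordan_Normal_Form.Determinant"
    "Jordan_Normal_Form.DL_Submatrix"
    "Jordan_Normal_Form.DL_Rank"
begin

section \<open>Polynomial rings in finitely many variables\<close>

text \<open>A multivariate polynomial is a finitely supported map from exponent vectors to
  coefficients, with variables indexed by all of \<^typ>\<open>nat\<close>; the ring structure is that of
  \<^theory>\<open>HOL-Library.Poly_Mapping\<close>. Polynomial rings in \<open>d\<close> variables (indexed by
  \<open>0, \<dots>, d - 1\<close>) are carved out as carriers.\<close>

type_synonym 'a mpol = "(nat \<Rightarrow>\<^sub>0 nat) \<Rightarrow>\<^sub>0 'a"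

definition mono :: "(nat \<Rightarrow>\<^sub>0 nat) \<Rightarrow> 'a::comm_ring_1 mpol"
  where "mono u = Poly_Mapping.single u 1"

definition var :: "nat \<Rightarrow> 'a::comm_ring_1 mpol"
  where "var i = mono (Poly_Mapping.single i 1)"

definition const :: "'a::comm_ring_1 \<Rightarrow> 'a mpol"
  where "const c = Poly_Mapping.single 0 c"

definition polys_in :: "nat \<Rightarrow> 'a::comm_ring_1 set \<Rightarrow> 'a mpol set"
  where "polys_in d A =
    {p. (\<forall>m \<in> Poly_Mapping.keys p. Poly_Mapping.keys m \<subseteq> {..<d}) \<and> range (Poly_Mapping.lookup p) \<subseteq> A}"

definition ring_on :: "'a::comm_ring_1 set \<Rightarrow> 'a ring"
  where "ring_on A = \<lparr>carrier = A, monoid.mult = (*), one = 1, zero = 0, add = (+)\<rparr>"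

definition base_ring :: "nat \<Rightarrow> 'k::field mpol ring"
  where "base_ring n = ring_on (polys_in n UNIV)"

text \<open>The ring \<open>R[T\<^sub>0, \<dots>, T\<^sub>r\<^sub>-\<^sub>1]\<close> over \<open>R = k[x\<^sub>0, \<dots>, x\<^sub>n\<^sub>-\<^sub>1]\<close>: \<open>x\<^sub>i\<close> is
  \<^term>\<open>const (var i)\<close> and \<open>T\<^sub>i\<close> is \<^term>\<open>var i\<close>.\<close>

definition sym_ring :: "nat \<Rightarrow> nat \<Rightarrow> 'k::field mpol mpol ring"
  where "sym_ring n r = ring_on (polys_in r (polys_in n UNIV))"

section \<open>Edge ideals and Rees algebras\<close>

definition simple_graph :: "nat \<Rightarrow> nat set set \<Rightarrow> bool"
  where "simple_graph n E \<longleftrightarrow> (\<forall>e \<in> E. e \<subseteq> {..<n} \<and> card e = 2)"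

definition edge_exp :: "nat set \<Rightarrow> (nat \<Rightarrow>\<^sub>0 nat)"
  where "edge_exp e = (\<Sum>v\<in>e. Poly_Mapping.single v 1)"

definition edge_mono :: "nat set \<Rightarrow> 'k::field mpol"
  where "edge_mono e = mono (edge_exp e)"

definition edge_ideal :: "nat \<Rightarrow> nat set set \<Rightarrow> 'k::field mpol set"
  where "edge_ideal n E = Idl\<^bsub>base_ring n\<^esub> (edge_mono ` E)"

text \<open>In \<^const>\<open>ideals_set\<close> the multiplication is the product of ideals and the unit is the
  whole ring, so the power below is the usual \<open>I\<^sup>i\<close> with \<open>I\<^sup>0 = R\<close>.\<close>

definition rees_algebra :: "nat \<Rightarrow> 'k::field mpol set \<Rightarrow> 'k mpol poly ring"
  where "rees_algebra n I =
    ring_on {p. \<forall>i. Polynomial.coeff p i \<in> I [^]\<^bsub>ideals_set (base_ring n)\<^esub> i}"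

text \<open>The \<open>R\<close>-algebra map \<open>R[T] \<rightarrow> R[t]\<close> sending \<open>T\<^sub>i\<close> to \<open>f\<^sub>i t\<close>.\<close>

definition rees_map :: "(nat \<Rightarrow> 'k::field mpol) \<Rightarrow> 'k mpol mpol \<Rightarrow> 'k mpol poly"
  where "rees_map f P =
    (\<Sum>m \<in> Poly_Mapping.keys P. Polynomial.smult (Poly_Mapping.lookup P m)
       (\<Prod>i \<in> Poly_Mapping.keys m. Polynomial.monom (f i) 1 ^ Poly_Mapping.lookup m i))"

definition rees_ideal :: "nat \<Rightarrow> nat set list \<Rightarrow> 'k::field mpol mpol set"
  where "rees_ideal n es =
    a_kernel (sym_ring n (length es)) (rees_algebra n (edge_ideal n (set es)))
      (rees_map (\<lambda>i. edge_mono (es ! i)))"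

section \<open>Taylor presentation matrix and Jacobian dual\<close>

text \<open>Subtraction of exponent vectors is truncated at each component; see the lemma below.\<close>

definition exp_lcm :: "(nat \<Rightarrow>\<^sub>0 nat) \<Rightarrow> (nat \<Rightarrow>\<^sub>0 nat) \<Rightarrow> (nat \<Rightarrow>\<^sub>0 nat)"
  where "exp_lcm u v = u + (v - u)"

lemma lookup_exp_lcm:
  "Poly_Mapping.lookup (exp_lcm u v) i = max (Poly_Mapping.lookup u i) (Poly_Mapping.lookup v i)"
  by (simp add: exp_lcm_def lookup_add lookup_minus)

definition pairs :: "nat \<Rightarrow> (nat \<times> nat) list"
  where "pairs r = [(j, k). j \<leftarrow> [0..<r], k \<leftarrow> [Suc j..<r]]"

definition taylor_mat :: "nat set list \<Rightarrow> 'k::field mpol mat"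
  where "taylor_mat es =
    mat (length es) (length (pairs (length es)))
      (\<lambda>(i, c). case pairs (length es) ! c of (j, k) \<Rightarrow>
         let u = edge_exp (es ! j); v = edge_exp (es ! k) in
         if i = j then - mono (exp_lcm u v - u)
         else if i = k then mono (exp_lcm u v - v)
         else 0)"

text \<open>The \<open>1 \<times> c\<close> matrix \<open>T \<cdot> \<phi>\<close>.\<close>

definition T_row_mult :: "'k::field mpol mat \<Rightarrow> 'k mpol mpol mat"
  where "T_row_mult \<phi> = mat 1 (dim_row \<phi>) (\<lambda>(_, i). var i) * map_mat const \<phi>"

definition T_linear :: "nat \<Rightarrow> nat \<Rightarrow> 'k::field mpol mpol \<Rightarrow> bool"
  where "T_linear n r P \<longleftrightarrow> P \<in> carrier (sym_ring n r) \<and>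
    (\<forall>m \<in> Poly_Mapping.keys P. \<exists>i<r. m = Poly_Mapping.single i 1)"

definition jacobian_dual :: "nat \<Rightarrow> 'k::field mpol mat \<Rightarrow> 'k mpol mpol mat \<Rightarrow> bool"
  where "jacobian_dual n \<phi> B \<longleftrightarrow>
    B \<in> carrier_mat n (dim_col \<phi>) \<and>
    (\<forall>P \<in> elements_mat B. T_linear n (dim_row \<phi>) P) \<and>
    T_row_mult \<phi> = mat 1 n (\<lambda>(_, i). const (var i)) * B"

text \<open>Reduction modulo \<open>(x\<^sub>0, \<dots>, x\<^sub>n\<^sub>-\<^sub>1)\<close> replaces each coefficient in \<open>R\<close> by its constant
  term; the result lives in \<open>k[T]\<close>, which \<open>incl_T\<close> embeds back into \<open>R[T]\<close>.\<close>

definition reduce :: "'k::field mpol mpol \<Rightarrow> 'k mpol"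
  where "reduce P = Poly_Mapping.map (\<lambda>c. Poly_Mapping.lookup c 0) P"

definition incl_T :: "'k::field mpol \<Rightarrow> 'k mpol mpol"
  where "incl_T p = Poly_Mapping.map const p"

section \<open>Minors\<close>

definition minors :: "nat \<Rightarrow> 'a::comm_ring_1 mat \<Rightarrow> 'a set"
  where "minors t M = {det (submatrix M I J) | I J.
    I \<subseteq> {..<dim_row M} \<and> J \<subseteq> {..<dim_col M} \<and> card I = t \<and> card J = t}"

text \<open>The two monomials have to be distinct: otherwise, in characteristic 3, every \<open>-m\<close> would
  be a binomial \<open>m + m\<close>.\<close>

definition binomial_poly :: "'a::comm_ring_1 mpol \<Rightarrow> bool"
  where "binomial_poly p \<longleftrightarrow> (\<exists>u v. u \<noteq> v \<and> (p = mono u + mono v \<or> p = mono u - mono v))"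

definition bi :: "nat \<Rightarrow> 'a::comm_ring_1 mpol mat \<Rightarrow> 'a mpol set"
  where "bi t M = {p \<in> minors t M. binomial_poly p}"

text \<open>Rank over the field of fractions.\<close>

definition mat_rank :: "'a::idom mat \<Rightarrow> nat"
  where "mat_rank M = vec_space.rank (dim_row M) (map_mat (\<lambda>p. Fract p 1) M)"

end

(* In k[x,T] the defining ideal is spanned by binomials x^A T^U - x^B T^V in which A and the edges
   of U have together the same vertex degrees as B and the edges of V, and U and V have the same
   size. If A is nonempty, one Taylor relation gives x^A T^U a variable in common with x^B T^V,
   which is then cancelled. If A is empty, U and V can be oriented so that their tails agree and
   their heads agree; following heads and tails alternately splits off even closed walks whose
   even vertices are distinct. The binomial of such a walk is, up to sign, the minor of the reduced
   Jacobian dual with these vertices as rows and the paths of length two between consecutive ones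
   as columns.

   Conversely, a square submatrix with two nonzero entries in every column becomes singular in the
   Rees algebra because the row vector of the x_i kills it; the other minors reduce to this case by
   Laplace expansion, or are plus or minus a monomial. *)

theory Submission
  imports Defs
begin

section \<open>Balanced edge multisets and cyclic matrices\<close>

text \<open>The rows of a submatrix are distinct vertices, so the even vertices of a walk must not
  repeat. Its odd vertices may: each is only the middle of a path that selects a column. Repetition
  is avoided by choosing one outgoing arc for each even vertex. The walk is then a cycle of a
  self-map of a finite set, encoded as a minimal nonempty invariant subset, so that its vertices
  never have to be listed in order. The bound \<open>k\<close> on the size of the minors comes for
  free, because a nonzero minor of size \<open>t\<close> already shows that the rank is at least
  \<open>t\<close>. The obstacle is the signs: rows are sorted as vertices and columns as pairs of
  edges, and neither order is related to the walk. Signs are recovered afterwards. Both terms of the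
  minor have the same image in the Rees algebra, and the minor itself goes to zero there, so equal
  signs can occur only in characteristic 2, where they are immaterial. Hence the vanishing of
  determinants with two nonzero entries per column serves both inclusions.\<close>

definition edge_sum :: "'v set multiset \<Rightarrow> 'v multiset"
  where "edge_sum U = (\<Sum>e\<in>#U. mset_set e)"

lemma edge_sum_simps [simp]:
  "edge_sum {#} = {#}"
  "edge_sum (add_mset e U) = mset_set e + edge_sum U"
  "edge_sum (U + V) = edge_sum U + edge_sum V"
  by (simp_all add: edge_sum_def)

lemma in_edge_sumE:
  assumes "v \<in># edge_sum U"
  obtains e U' where "U = add_mset e U'" and "v \<in> e"
proof -
  have "\<exists>e\<in>#U. v \<in> e"
    using assms
  proof (induction U)
    case (add e U)
    then show ?case by (cases "finite e") auto
  qed simp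
  then show thesis using that by (metis multi_member_split)
qed

lemma card_2_other:
  assumes "card e = 2" and "v \<in> e"
  obtains w where "e = {v, w}" and "v \<noteq> w"
proof -
  obtain x y where "e = {x, y}" "x \<noteq> y" using assms(1) by (auto simp: card_2_iff)
  then show thesis using assms(2) that by (cases "v = x") auto
qed

section \<open>Alternating trails and their orientation\<close>

abbreviation ends :: "'v \<times> 'v \<Rightarrow> 'v set"
  where "ends p \<equiv> {fst p, snd p}"

text \<open>The vertices \<open>s\<close> and \<open>t\<close> are the two ends of an alternating trail that is being traversed;
  the case of interest is \<open>s = t\<close>.\<close>

lemma balanced_orientation:
  assumes "add_mset s (edge_sum U) = add_mset t (edge_sum V)" and "size U = size V"
    and "\<And>e. e \<in># U \<Longrightarrow> card e = 2" and "\<And>e. e \<in># V \<Longrightarrow> card e = 2"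
  shows "\<exists>D F. image_mset ends D = U \<and> image_mset ends F = V \<and>
    add_mset s (image_mset fst D) = add_mset t (image_mset fst F) \<and>
    image_mset snd D = image_mset snd F"
  using assms
proof (induction "size V" arbitrary: s t U V)
  case 0
  then show ?case by auto
next
  case (Suc n)
  \<comment> \<open>If \<open>s = t\<close>, the trail has closed up and is restarted at any vertex
    of \<open>V\<close>; otherwise it goes on from \<open>s\<close>. The last conjunct carries the
    result back: in the closed case both equations amount to \<open>M = N\<close>.\<close>
  have "\<exists>s' t'. s' \<in># edge_sum V \<and> add_mset s' (edge_sum U) = add_mset t' (edge_sum V) \<and>
      (\<forall>M N. add_mset s' M = add_mset t' N \<longrightarrow> add_mset s M = add_mset t N)"
  proof (cases "s = t")
    case True
    obtain f where f: "f \<in># V" using Suc.hyps(2) by (metis multiset_nonemptyE size_empty nat.distinct(1))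
    then obtain x y where "f = {x, y}" "x \<noteq> y" using Suc.prems(4) by (metis card_2_iff)
    then have "x \<in># edge_sum V" using f by (auto dest!: multi_member_split)
    then show ?thesis using True Suc.prems(1) by auto
  next
    case False
    then have "s \<in># edge_sum V" using Suc.prems(1) by (metis insert_noteq_member)
    then show ?thesis using Suc.prems(1) by blast
  qed
  then obtain s' t' where s': "s' \<in># edge_sum V"
    and bal: "add_mset s' (edge_sum U) = add_mset t' (edge_sum V)"
    and swap: "\<And>M N. add_mset s' M = add_mset t' N \<Longrightarrow> add_mset s M = add_mset t N"
    by blast
  obtain f V' where V: "V = add_mset f V'" and "s' \<in> f" using s' by (rule in_edge_sumE)
  moreover have "card f = 2" using Suc.prems(4) V by simp
  ultimately obtain y where f: "f = {s', y}" "s' \<noteq> y" by (metis card_2_other)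
  have "y \<in># add_mset s' (edge_sum U)" unfolding bal V using f by simp
  then have "y \<in># edge_sum U" using f by simp
  then obtain e U' where U: "U = add_mset e U'" and "y \<in> e" by (rule in_edge_sumE)
  moreover have "card e = 2" using Suc.prems(3) U by simp
  ultimately obtain z where e: "e = {y, z}" "y \<noteq> z" by (metis card_2_other)
  \<comment> \<open>Going along \<open>f\<close> from \<open>s'\<close> to \<open>y\<close> and
    along \<open>e\<close> from \<open>y\<close> to \<open>z\<close> moves the open end to
    \<open>z\<close>. Both edges get \<open>y\<close> as second component, which keeps the second
    components balanced.\<close>
  have "add_mset z (edge_sum U') = add_mset t' (edge_sum V')"
    using bal f e by (simp add: U V add_mset_commute)
  then obtain D F where DF: "image_mset ends D = U'" "image_mset ends F = V'"
    "add_mset z (image_mset fst D) = add_mset t' (image_mset fst F)"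
    "image_mset snd D = image_mset snd F"
    using Suc.hyps(1)[of V' z U' t'] Suc.hyps(2) Suc.prems U V by auto
  have "add_mset s' (image_mset fst (add_mset (z, y) D)) =
      add_mset t' (image_mset fst (add_mset (s', y) F))"
    using DF(3) by (simp add: add_mset_commute)
  then have "add_mset s (image_mset fst (add_mset (z, y) D)) =
      add_mset t (image_mset fst (add_mset (s', y) F))"
    by (rule swap)
  moreover have "image_mset ends (add_mset (z, y) D) = U" "image_mset ends (add_mset (s', y) F) = V"
    using DF U V e f by auto
  moreover have "image_mset snd (add_mset (z, y) D) = image_mset snd (add_mset (s', y) F)"
    using DF by simp
  ultimately show ?case by blast
qed

text \<open>A minimal nonempty invariant subset is a cycle of \<open>g\<close>: its image is again
  invariant, hence is all of it. Minimality stays in the conclusion, because it expresses that there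
  is only one cycle.\<close>

lemma minimal_invariant_subset:
  assumes "finite A" and "A \<noteq> {}" and "g ` A \<subseteq> A"
  obtains C where "C \<noteq> {}" and "C \<subseteq> A" and "g ` C = C"
    and "\<And>D. D \<subseteq> C \<Longrightarrow> D \<noteq> {} \<Longrightarrow> g ` D \<subseteq> D \<Longrightarrow> D = C"
proof -
  let ?P = "\<lambda>C. C \<noteq> {} \<and> C \<subseteq> A \<and> g ` C \<subseteq> C"
  obtain C where C: "?P C" and min: "\<And>D. ?P D \<Longrightarrow> card C \<le> card D"
    using ex_has_least_nat[of ?P A card] assms by blast
  have fin: "finite C" using C assms(1) finite_subset by blast
  have *: "D = C" if "D \<subseteq> C" "D \<noteq> {}" "g ` D \<subseteq> D" for D
    using min[of D] that C fin by (meson card_seteq order_trans)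
  have "g ` C = C" by (rule *) (use C in auto)
  then show thesis using that C * by blast
qed

text \<open>The columns of \<open>M\<close> are the steps \<open>a \<rightarrow> g a\<close> of a cyclic permutation \<open>g\<close>; only two
  permutations contribute to the Leibniz formula.\<close>

lemma det_cyclic:
  fixes M :: "'a::comm_ring_1 mat"
  assumes M: "M \<in> carrier_mat t t" and \<alpha>: "bij_betw \<alpha> {0..<t} C" and \<beta>: "bij_betw \<beta> {0..<t} C"
    and C: "C \<noteq> {}" and g: "bij_betw g C C" and ne: "\<And>a. a \<in> C \<Longrightarrow> g a \<noteq> a"
    and min: "\<And>D. D \<subseteq> C \<Longrightarrow> D \<noteq> {} \<Longrightarrow> g ` D \<subseteq> D \<Longrightarrow> D = C"
    and entries: "\<And>i j. i < t \<Longrightarrow> j < t \<Longrightarrow> M $$ (i, j) =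
      (if \<alpha> i = \<beta> j then y (\<beta> j) else if \<alpha> i = g (\<beta> j) then z (\<beta> j) else 0)"
  shows "\<exists>s1\<in>{1, -1}. \<exists>s2\<in>{1, -1}. det M = s1 * prod y C + s2 * prod z C"
proof -
  have t: "0 < t" using \<alpha> C by (cases t) (auto simp: bij_betw_def)
  have perm: "\<exists>q. q permutes {0..<t} \<and> (\<forall>i<t. \<delta> (q i) = \<alpha> i)"
    if \<delta>: "bij_betw \<delta> {0..<t} C" for \<delta>
  proof -
    let ?q = "\<lambda>i. if i \<in> {0..<t} then (inv_into {0..<t} \<delta> \<circ> \<alpha>) i else i"
    have "bij_betw (inv_into {0..<t} \<delta> \<circ> \<alpha>) {0..<t} {0..<t}"
      using \<alpha> bij_betw_inv_into[OF \<delta>] by (rule bij_betw_trans)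
    then have "bij_betw ?q {0..<t} {0..<t}"
      by (subst bij_betw_cong[where g = "inv_into {0..<t} \<delta> \<circ> \<alpha>"]) auto
    then have "?q permutes {0..<t}" by (rule bij_imp_permutes) auto
    moreover have "\<delta> (?q i) = \<alpha> i" if "i < t" for i
      using that bij_betw_inv_into_right[OF \<delta>] bij_betwE[OF \<alpha>] by simp
    ultimately show ?thesis by blast
  qed
  \<comment> \<open>\<open>q0\<close> selects the entry \<open>y\<close> in every column,
    \<open>q1\<close> the entry \<open>z\<close> in every column.\<close>
  obtain q0 where q0: "q0 permutes {0..<t}" and q0': "\<And>i. i < t \<Longrightarrow> \<beta> (q0 i) = \<alpha> i"
    using perm[OF \<beta>] by blast
  obtain q1 where q1: "q1 permutes {0..<t}" and q1': "\<And>i. i < t \<Longrightarrow> g (\<beta> (q1 i)) = \<alpha> i"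
    using perm[OF bij_betw_trans[OF \<beta> g]] by auto
  have \<beta>C: "\<beta> j \<in> C" if "j < t" for j using bij_betwE[OF \<beta>] that by simp
  have \<beta>inj: "i = j" if "\<beta> i = \<beta> j" "i < t" "j < t" for i j
    using \<beta> that by (auto simp: bij_betw_def inj_on_def)
  have \<alpha>inj: "i = j" if "\<alpha> i = \<alpha> j" "i < t" "j < t" for i j
    using \<alpha> that by (auto simp: bij_betw_def inj_on_def)
  have ginj: "a = b" if "g a = g b" "a \<in> C" "b \<in> C" for a b
    using g that by (auto simp: bij_betw_def inj_on_def)
  have lt: "p i < t" if "p permutes {0..<t}" "i < t" for p i
    using permutes_in_image[OF that(1)] that(2) by auto
  have neq: "q0 \<noteq> q1"
    using q0'[OF t] q1'[OF t] ne[OF \<beta>C[OF lt[OF q0 t]]] by auto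
  have eqI: "p = q" if p: "p permutes {0..<t}" and q: "q permutes {0..<t}"
    and eq: "\<And>i. i < t \<Longrightarrow> p i = q i" for p q
  proof
    fix i show "p i = q i" using p q eq by (cases "i < t") (auto simp: permutes_def)
  qed
  have zero: "(\<Prod>i=0..<t. M $$ (i, p i)) = 0"
    if p: "p permutes {0..<t}" and "p \<noteq> q0" "p \<noteq> q1" for p
  proof (rule ccontr)
    assume "(\<Prod>i=0..<t. M $$ (i, p i)) \<noteq> 0"
    then have nz: "M $$ (i, p i) \<noteq> 0" if "i < t" for i
      using that by (metis atLeastLessThan_iff finite_atLeastLessThan le0 prod_zero)
    have or: "\<alpha> i = \<beta> (p i) \<or> \<alpha> i = g (\<beta> (p i))" if "i < t" for i
      using nz[OF that] entries[OF that lt[OF p that]] by presburger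
    \<comment> \<open>These are the columns in which \<open>p\<close> selects the entry
      \<open>z\<close>. They form an invariant set, so they are none or all of the columns.\<close>
    let ?D = "{\<beta> (p i) |i. i < t \<and> \<alpha> i = g (\<beta> (p i))}"
    have sub: "?D \<subseteq> C" using \<beta>C lt[OF p] by auto
    have "g ` ?D \<subseteq> ?D"
    proof (safe)
      fix i assume i: "i < t" "\<alpha> i = g (\<beta> (p i))"
      have "g (\<beta> (p i)) \<in> C" using \<beta>C lt[OF p] i g by (auto dest: bij_betwE)
      then obtain j where j: "j < t" "\<beta> j = g (\<beta> (p i))"
        using \<beta> by (metis atLeastLessThan_iff bij_betw_iff_bijections)
      obtain i' where i': "i' < t" "p i' = j"
        using p j by (metis atLeastLessThan_iff le0 permutes_def permutes_in_image)
      \<comment> \<open>Equality would give \<open>\<alpha> i' = \<alpha> i\<close>, hence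
        \<open>i' = i\<close> and \<open>j = p i\<close>, and \<open>g\<close> would fix
        \<open>\<beta> (p i)\<close>.\<close>
      have "\<alpha> i' \<noteq> \<beta> (p i')"
        using i' i j \<alpha>inj[of i' i] ne[OF \<beta>C[OF lt[OF p i(1)]]] by auto
      then have "\<alpha> i' = g (\<beta> (p i'))" using or i' by blast
      then show "\<exists>i'. g (\<beta> (p i)) = \<beta> (p i') \<and> i' < t \<and> \<alpha> i' = g (\<beta> (p i'))"
        using i' j by (intro exI[of _ i']) auto
    qed
    then consider "?D = {}" | "?D = C" using min sub by blast
    then show False
    proof cases
      case 1
      then have "\<And>i. i < t \<Longrightarrow> \<alpha> i = \<beta> (p i)" using or by blast
      then have "p = q0" using q0' \<beta>inj lt p q0 by (intro eqI) metis+
      then show False using that by blast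
    next
      case 2
      have "p i = q1 i" if i: "i < t" for i
      proof -
        have "\<beta> (p i) \<in> ?D" using 2 \<beta>C lt[OF p i] by blast
        then obtain j where j: "j < t" "\<beta> (p i) = \<beta> (p j)" "\<alpha> j = g (\<beta> (p j))" by blast
        then have "p i = p j" using \<beta>inj lt p i by blast
        then have "i = j" using permutes_inj[OF p] by (auto simp: inj_def)
        then show ?thesis using j q1'[OF i] ginj \<beta>C \<beta>inj lt p q1 i by metis
      qed
      then have "p = q1" using eqI p q1 by blast
      then show False using that by blast
    qed
  qed
  have bij: "bij_betw (\<beta> \<circ> q) {0..<t} C" if "q permutes {0..<t}" for q
    using permutes_imp_bij[OF that] \<beta> by (rule bij_betw_trans)
  have "(\<Prod>i=0..<t. M $$ (i, q0 i)) = (\<Prod>i=0..<t. y ((\<beta> \<circ> q0) i))"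
    by (rule prod.cong) (use q0' lt[OF q0] in \<open>auto simp: entries\<close>)
  also have "\<dots> = prod y C" by (rule prod.reindex_bij_betw[OF bij[OF q0]])
  finally have P0: "(\<Prod>i=0..<t. M $$ (i, q0 i)) = prod y C" .
  have "(\<Prod>i=0..<t. M $$ (i, q1 i)) = (\<Prod>i=0..<t. z ((\<beta> \<circ> q1) i))"
  proof (rule prod.cong)
    fix i assume "i \<in> {0..<t}"
    then have i: "i < t" by simp
    show "M $$ (i, q1 i) = z ((\<beta> \<circ> q1) i)"
      using q1'[OF i] ne[OF \<beta>C[OF lt[OF q1 i]]] by (auto simp: entries i lt[OF q1 i])
  qed simp
  also have "\<dots> = prod z C" by (rule prod.reindex_bij_betw[OF bij[OF q1]])
  finally have P1: "(\<Prod>i=0..<t. M $$ (i, q1 i)) = prod z C" .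
  have "det M = (\<Sum>p\<in>{p. p permutes {0..<t}}. signof p * (\<Prod>i=0..<t. M $$ (i, p i)))"
    by (rule det_def'[OF M])
  also have "\<dots> = (\<Sum>p\<in>{q0, q1}. signof p * (\<Prod>i=0..<t. M $$ (i, p i)))"
    by (rule sum.mono_neutral_right) (use q0 q1 zero in \<open>auto simp: finite_permutations\<close>)
  also have "\<dots> = signof q0 * prod y C + signof q1 * prod z C"
    using neq by (simp add: P0 P1)
  finally show ?thesis by (intro bexI[of _ "signof q0"] bexI[of _ "signof q1"]) (auto simp: sign_def)
qed

section \<open>Minors and rank\<close>

lemma submatrix_carrier:
  assumes "I \<subseteq> {..<dim_row M}" and "J \<subseteq> {..<dim_col M}"
  shows "submatrix M I J \<in> carrier_mat (card I) (card J)"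
proof -
  have "{i. i < dim_row M \<and> i \<in> I} = I" "{j. j < dim_col M \<and> j \<in> J} = J"
    using assms by auto
  then show ?thesis unfolding carrier_mat_def mem_Collect_eq dim_submatrix by metis
qed

lemma submatrix_nth:
  assumes "I \<subseteq> {..<dim_row M}" and "J \<subseteq> {..<dim_col M}" and "i < card I" and "j < card J"
  shows "submatrix M I J $$ (i, j) = M $$ (pick I i, pick J j)"
proof -
  have "{i. i < dim_row M \<and> i \<in> I} = I" "{j. j < dim_col M \<and> j \<in> J} = J"
    using assms by auto
  then show ?thesis using assms submatrix_index[of i M I j J] by metis
qed

lemma bij_betw_pick:
  assumes "finite I"
  shows "bij_betw (pick I) {0..<card I} I"
proof -
  have "inj_on (pick I) {0..<card I}"
    by (rule inj_onI) (metis atLeastLessThan_iff linorder_neqE_nat nat_neq_iff pick_mono_le)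
  moreover have "pick I ` {0..<card I} \<subseteq> I"
    using pick_in_set_le by auto
  ultimately show ?thesis
    using assms by (simp add: bij_betw_def card_image card_subset_eq)
qed

text \<open>A vector killed by the full columns indexed by \<open>J\<close> is also killed by the
  square submatrix, so a nonzero minor makes these columns independent over the fraction
  field.\<close>

lemma minor_le_mat_rank:
  fixes M :: "'a::idom mat"
  assumes I: "I \<subseteq> {..<dim_row M}" and J: "J \<subseteq> {..<dim_col M}" and IJ: "card I = card J"
    and det: "det (submatrix M I J) \<noteq> 0"
  shows "card J \<le> mat_rank M"
proof -
  interpret hom: inj_comm_ring_hom "to_fract :: 'a \<Rightarrow> 'a fract"
    by (unfold_locales, auto)
  let ?n = "dim_row M" and ?t = "card J"
  interpret vec_space "TYPE('a fract)" ?n .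
  define A where "A = map_mat (to_fract :: 'a \<Rightarrow> 'a fract) M"
  have A: "A \<in> carrier_mat ?n (dim_col M)" by (rule carrier_matI) (simp_all add: A_def)
  have pickI: "pick I i < ?n" if "i < ?t" for i
    using pick_in_set_le[of i I] that IJ I by auto
  have pickJ: "pick J j < dim_col M" if "j < ?t" for j
    using pick_in_set_le[of j J] that J by auto
  define B where "B = mat ?n ?t (\<lambda>(i, j). A $$ (i, pick J j))"
  define S where "S = map_mat (to_fract :: 'a \<Rightarrow> 'a fract) (submatrix M I J)"
  have S: "S \<in> carrier_mat ?t ?t" using submatrix_carrier[OF I J] by (simp add: S_def IJ)
  have S_nth: "S $$ (i, j) = B $$ (pick I i, j)" if "i < ?t" "j < ?t" for i j
    using that submatrix_carrier[OF I J] pickI pickJ IJ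
    by (simp add: S_def B_def A_def submatrix_nth[OF I J])
  have B: "B \<in> carrier_mat ?n ?t" by (simp add: B_def)
  have "det S \<noteq> 0" using det by (simp add: S_def)
  then have ker: "v = 0\<^sub>v ?t" if "v \<in> carrier_vec ?t" "B *\<^sub>v v = 0\<^sub>v ?n" for v
  proof -
    have "S *\<^sub>v v = 0\<^sub>v ?t"
    proof (rule eq_vecI)
      fix i assume "i < dim_vec (0\<^sub>v ?t :: 'a fract vec)"
      then have i: "i < ?t" by simp
      have "row S i = row B (pick I i)"
        using S B i pickI S_nth by (intro eq_vecI) auto
      then have "(S *\<^sub>v v) $ i = (B *\<^sub>v v) $ pick I i"
        using S B i pickI by simp
      then show "(S *\<^sub>v v) $ i = 0\<^sub>v ?t $ i" using that(2) i pickI by simp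
    qed (use S in simp)
    then show ?thesis using \<open>det S \<noteq> 0\<close> that(1) det_0_iff_vec_prod_zero[OF S] by blast
  qed
  \<comment> \<open>Independence concerns the set of columns; distinctness ensures that this set has
    \<open>?t\<close> elements.\<close>
  have dist: "distinct (cols B)"
  proof (rule ccontr)
    assume "\<not> distinct (cols B)"
    then obtain i j where ij: "i < ?t" "j < ?t" "i \<noteq> j" "col B i = col B j"
      using B by (auto simp: distinct_conv_nth)
    have "col S i = col S j"
    proof (rule eq_vecI)
      fix l assume "l < dim_vec (col S j)"
      then have l: "l < ?t" using S by simp
      have "col B i $ pick I l = col B j $ pick I l" using ij by simp
      then show "col S i $ l = col S j $ l" using S B ij(1,2) l pickI by (simp add: S_nth)
    qed (use S in simp)
    then have "det S = 0" using det_identical_cols[OF S] ij by blast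
    then show False using \<open>det S \<noteq> 0\<close> by blast
  qed
  have "lin_indpt (set (cols B))"
    using lin_depE[OF B _ dist] ker by blast
  moreover have "set (cols B) \<subseteq> set (cols A)"
  proof
    fix x assume "x \<in> set (cols B)"
    then obtain j where j: "j < ?t" "x = col B j" using B by (auto simp: in_set_conv_nth)
    then have "x = col A (pick J j)" using A pickJ by (intro eq_vecI) (auto simp: B_def)
    then show "x \<in> set (cols A)"
      using A pickJ[OF j(1)] by (metis carrier_matD(2) cols_length cols_nth nth_mem)
  qed
  ultimately have "card (set (cols B)) \<le> rank A" using rank_ge_card_indpt[OF A] by blast
  moreover have "mat_rank M = rank A"
    by (simp add: mat_rank_def A_def to_fract_def[abs_def])
  ultimately show ?thesis using dist B by (simp add: distinct_card)
qed

section \<open>Ring homomorphisms of polynomial rings\<close>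

lemma sum_single_lookup:
  "(\<Sum>m\<in>Poly_Mapping.keys p. Poly_Mapping.single m (Poly_Mapping.lookup p m)) = p"
  by (rule poly_mapping_eqI)
    (auto simp: lookup_sum lookup_single when_def in_keys_iff if_distrib cong: if_cong)

text \<open>A polynomial is the sum of its terms, so for an additive map multiplicativity only has
  to be tested on single terms.\<close>

lemma additive_mult_hom:
  fixes h :: "('m::comm_monoid_add \<Rightarrow>\<^sub>0 'b::comm_semiring_0) \<Rightarrow> 'c::comm_ring_1"
  assumes add: "\<And>p q. h (p + q) = h p + h q" and zero: "h 0 = 0"
    and single: "\<And>m c m' c'. h (Poly_Mapping.single (m + m') (c * c')) =
      h (Poly_Mapping.single m c) * h (Poly_Mapping.single m' c')"
  shows "h (p * q) = h p * h q"
proof -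
  have sum: "h (sum f A) = (\<Sum>x\<in>A. h (f x))" for f :: "'x \<Rightarrow> _" and A
    using sum_comp_morphism[of h f A] zero add by simp
  let ?s = "\<lambda>p m. Poly_Mapping.single m (Poly_Mapping.lookup p m)"
  have "p * q = (\<Sum>m\<in>Poly_Mapping.keys p. ?s p m) * (\<Sum>m\<in>Poly_Mapping.keys q. ?s q m)"
    by (simp only: sum_single_lookup)
  also have "h \<dots> = h (\<Sum>m\<in>Poly_Mapping.keys p. ?s p m) * h (\<Sum>m\<in>Poly_Mapping.keys q. ?s q m)"
    by (simp add: sum_product sum mult_single single)
  finally show ?thesis by (simp only: sum_single_lookup)
qed

lemma comm_ring_homI_single:
  fixes h :: "('m::comm_monoid_add \<Rightarrow>\<^sub>0 'b::comm_ring_1) \<Rightarrow> 'c::comm_ring_1"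
  assumes "\<And>p q. h (p + q) = h p + h q" and "h 1 = 1"
    and "\<And>m c m' c'. h (Poly_Mapping.single (m + m') (c * c')) =
      h (Poly_Mapping.single m c) * h (Poly_Mapping.single m' c')"
  shows "comm_ring_hom h"
proof -
  have "h 0 = h 0 + h 0" using assms(1)[of 0 0] by simp
  then have "h 0 = 0" by simp
  then show ?thesis
    by unfold_locales (use assms additive_mult_hom[of h] in auto)
qed

lemma comm_ring_hom_const: "comm_ring_hom (const :: 'a::comm_ring_1 \<Rightarrow> _)"
  by unfold_locales (simp_all add: const_def single_add mult_single)

global_interpretation const: comm_ring_hom "const :: 'a::comm_ring_1 \<Rightarrow> 'a mpol"
  by (rule comm_ring_hom_const)

lemma lookup_incl_T: "Poly_Mapping.lookup (incl_T p) m = const (Poly_Mapping.lookup p m)"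
  by (simp add: incl_T_def map.rep_eq when_def const_def)

lemma incl_T_single [simp]: "incl_T (Poly_Mapping.single m c) = Poly_Mapping.single m (const c)"
  by (rule poly_mapping_eqI) (simp add: lookup_incl_T lookup_single when_def const_def)

lemma comm_ring_hom_incl_T: "comm_ring_hom (incl_T :: 'k::field mpol \<Rightarrow> _)"
proof (rule comm_ring_homI_single)
  show "incl_T (p + q) = incl_T p + incl_T q" for p q :: "'k mpol"
    by (rule poly_mapping_eqI) (simp add: lookup_incl_T lookup_add const.hom_add)
  show "incl_T (1 :: 'k mpol) = 1"
    using incl_T_single[of 0 1] by (simp add: const.hom_one)
qed (simp add: mult_single const.hom_mult)

global_interpretation incl_T: comm_ring_hom "incl_T :: 'k::field mpol \<Rightarrow> _"
  by (rule comm_ring_hom_incl_T)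

section \<open>The Rees map as a ring homomorphism\<close>

definition rees_term :: "(nat \<Rightarrow> 'k::field mpol) \<Rightarrow> (nat \<Rightarrow>\<^sub>0 nat) \<Rightarrow> 'k mpol poly"
  where "rees_term f m = (\<Prod>i\<in>Poly_Mapping.keys m. Polynomial.monom (f i) 1 ^ Poly_Mapping.lookup m i)"

text \<open>Two exponents and their sum may have different supports; over a common larger index set
  the products can be compared factor by factor.\<close>

lemma rees_term_superset:
  assumes "finite K" and "Poly_Mapping.keys m \<subseteq> K"
  shows "rees_term f m = (\<Prod>i\<in>K. Polynomial.monom (f i) 1 ^ Poly_Mapping.lookup m i)"
  unfolding rees_term_def by (rule prod.mono_neutral_left) (use assms in \<open>auto simp: in_keys_iff\<close>)

lemma rees_term_add: "rees_term f (m + m') = rees_term f m * rees_term f m'"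
proof -
  let ?K = "Poly_Mapping.keys m \<union> Poly_Mapping.keys m'"
  have "rees_term f (m + m') = (\<Prod>i\<in>?K. Polynomial.monom (f i) 1 ^ Poly_Mapping.lookup (m + m') i)"
    by (rule rees_term_superset) (simp_all add: keys_add)
  then show ?thesis
    by (simp add: rees_term_superset[of ?K] lookup_add power_add prod.distrib)
qed

lemma rees_term_0 [simp]: "rees_term f 0 = 1"
  by (simp add: rees_term_def)

lemma rees_map_superset:
  assumes "finite K" and "Poly_Mapping.keys P \<subseteq> K"
  shows "rees_map f P = (\<Sum>m\<in>K. Polynomial.smult (Poly_Mapping.lookup P m) (rees_term f m))"
  unfolding rees_map_def rees_term_def[symmetric]
  by (rule sum.mono_neutral_left) (use assms in \<open>auto simp: in_keys_iff\<close>)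

lemma rees_map_single [simp]: "rees_map f (Poly_Mapping.single m c) = Polynomial.smult c (rees_term f m)"
  by (simp add: rees_map_superset[of "{m}"])

lemma rees_map_add: "rees_map f (P + Q) = rees_map f P + rees_map f Q"
proof -
  let ?K = "Poly_Mapping.keys P \<union> Poly_Mapping.keys Q"
  have "rees_map f (P + Q) = (\<Sum>m\<in>?K. Polynomial.smult (Poly_Mapping.lookup (P + Q) m) (rees_term f m))"
    by (rule rees_map_superset) (simp_all add: keys_add)
  then show ?thesis
    by (simp add: rees_map_superset[of ?K] lookup_add smult_add_left sum.distrib)
qed

lemma comm_ring_hom_rees_map: "comm_ring_hom (rees_map f :: 'k::field mpol mpol \<Rightarrow> _)"
proof (rule comm_ring_homI_single)
  show "rees_map f (1 :: 'k mpol mpol) = 1"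
    using rees_map_single[of f 0 1] by simp
qed (simp_all add: rees_map_add rees_term_add mult.commute)

global_interpretation rees_map: comm_ring_hom "rees_map f :: 'k::field mpol mpol \<Rightarrow> _" for f
  by (rule comm_ring_hom_rees_map)

section \<open>Monomials indexed by multisets\<close>

text \<open>Exponent vectors are written as multisets, so that multiplying monomials and counting
  vertex degrees both become addition of multisets, with induction and cancellation at hand.\<close>

definition exps :: "nat multiset \<Rightarrow> (nat \<Rightarrow>\<^sub>0 nat)"
  where "exps A = (\<Sum>i\<in>#A. Poly_Mapping.single i 1)"

lemma exps_simps [simp]:
  "exps {#} = 0"
  "exps (add_mset i A) = Poly_Mapping.single i 1 + exps A"
  "exps (A + B) = exps A + exps B"
  by (simp_all add: exps_def)

lemma lookup_exps [simp]: "Poly_Mapping.lookup (exps A) i = count A i"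
  by (induction A) (auto simp: lookup_add lookup_single when_def)

lemma keys_exps [simp]: "Poly_Mapping.keys (exps A) = set_mset A"
  by (auto simp: in_keys_iff)

lemma exps_inject [simp]: "exps A = exps B \<longleftrightarrow> A = B"
  by (metis lookup_exps multiset_eqI)

lemma exps_surj: obtains A where "m = exps A"
proof
  have "finite {i. 0 < Poly_Mapping.lookup m i}" by simp
  then show "m = exps (Abs_multiset (Poly_Mapping.lookup m))"
    by (intro poly_mapping_eqI) simp
qed

lemma edge_exp_eq: "edge_exp e = exps (mset_set e)"
  by (simp add: edge_exp_def exps_def sum_unfold_sum_mset)

lemma mono_mult: "mono u * mono v = mono (u + v)"
  by (simp add: mono_def mult_single)

lemma mono_0 [simp]: "mono 0 = 1"
  by (simp add: mono_def)

lemma mono_inject [simp]: "(mono u :: 'a::comm_ring_1 mpol) = mono v \<longleftrightarrow> u = v"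
  by (auto simp: mono_def dest!: arg_cong[where f = Poly_Mapping.keys])

lemma mono_nonzero [simp]: "(mono u :: 'a::comm_ring_1 mpol) \<noteq> 0"
  by (simp add: mono_def poly_mapping_eq_iff fun_eq_iff lookup_single when_def) (metis zero_neq_one)

lemma mono_exps_mset: "mono (exps A) = (\<Prod>i\<in>#A. var i)"
  by (induction A) (simp_all add: var_def mono_mult[symmetric])

lemma rees_term_exps: "rees_term f (exps U) = (\<Prod>i\<in>#U. Polynomial.monom (f i) 1)"
  by (induction U) (simp_all add: rees_term_add, simp add: rees_term_def)

section \<open>Subrings and their ideals\<close>

text \<open>All carriers are subsets of types that have ring operations already. Closure turns such
  a subset into a HOL-Algebra ring whose ideals can be handled with the operations of the
  type.\<close>

locale subring_set =
  fixes A :: "'a::comm_ring_1 set"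
  assumes one [simp]: "1 \<in> A"
    and add: "x \<in> A \<Longrightarrow> y \<in> A \<Longrightarrow> x + y \<in> A"
    and uminus: "x \<in> A \<Longrightarrow> - x \<in> A"
    and mult: "x \<in> A \<Longrightarrow> y \<in> A \<Longrightarrow> x * y \<in> A"
begin

lemma zero [simp]: "0 \<in> A"
  using add[OF one uminus[OF one]] by simp

lemma diff: "x \<in> A \<Longrightarrow> y \<in> A \<Longrightarrow> x - y \<in> A"
  using add[of x "- y"] uminus by simp

lemma sum: "(\<And>i. i \<in> I \<Longrightarrow> f i \<in> A) \<Longrightarrow> sum f I \<in> A"
  by (induction I rule: infinite_finite_induct) (auto intro: add)

lemma prod: "(\<And>i. i \<in> I \<Longrightarrow> f i \<in> A) \<Longrightarrow> prod f I \<in> A"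
  by (induction I rule: infinite_finite_induct) (auto intro: mult)

lemma det:
  assumes "M \<in> carrier_mat t t" and "\<And>i j. i < t \<Longrightarrow> j < t \<Longrightarrow> M $$ (i, j) \<in> A"
  shows "det M \<in> A"
proof -
  have "signof p \<in> A" for p :: "nat \<Rightarrow> nat"
    using uminus[OF one] by (simp add: sign_def)
  moreover have "p i < t" if "p permutes {0..<t}" "i < t" for p i
    using permutes_in_image[OF that(1)] that(2) by auto
  ultimately show ?thesis
    unfolding det_def'[OF assms(1)] by (intro sum mult prod) (auto intro: assms(2))
qed

lemma ring_ring_on: "ring (ring_on A)"
proof (rule ringI)
  show "abelian_group (ring_on A)"
  proof (rule abelian_groupI)
    fix x assume "x \<in> carrier (ring_on A)"
    then show "\<exists>y\<in>carrier (ring_on A). y \<oplus>\<^bsub>ring_on A\<^esub> x = \<zero>\<^bsub>ring_on A\<^esub>"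
      by (intro bexI[of _ "- x"]) (auto simp: ring_on_def uminus)
  qed (auto simp: ring_on_def add algebra_simps)
  show "Group.monoid (ring_on A)"
    by (rule monoidI) (auto simp: ring_on_def mult algebra_simps)
qed (auto simp: ring_on_def algebra_simps)

lemma ideal_ring_onD:
  assumes "ideal I (ring_on A)"
  shows "I \<subseteq> A" and "0 \<in> I" and "x \<in> I \<Longrightarrow> y \<in> I \<Longrightarrow> x + y \<in> I"
    and "a \<in> A \<Longrightarrow> x \<in> I \<Longrightarrow> a * x \<in> I"
proof -
  interpret ideal I "ring_on A" by (rule assms)
  show "I \<subseteq> A" using a_subset by (simp add: ring_on_def)
  show "0 \<in> I" using additive_subgroup.zero_closed[OF is_additive_subgroup] by (simp add: ring_on_def)
  show "x + y \<in> I" if "x \<in> I" "y \<in> I" using additive_subgroup.a_closed[OF is_additive_subgroup that] by (simp add: ring_on_def)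
  show "a * x \<in> I" if "a \<in> A" "x \<in> I"
    using I_l_closed[OF that(2), of a] that(1) by (simp add: ring_on_def)
qed

lemma ideal_ring_onI:
  assumes "I \<subseteq> A" and "0 \<in> I" and "\<And>x y. x \<in> I \<Longrightarrow> y \<in> I \<Longrightarrow> x + y \<in> I"
    and "\<And>a x. a \<in> A \<Longrightarrow> x \<in> I \<Longrightarrow> a * x \<in> I"
  shows "ideal I (ring_on A)"
proof (rule idealI[OF ring_ring_on])
  interpret ring "ring_on A" by (rule ring_ring_on)
  show "subgroup I (add_monoid (ring_on A))"
  proof (rule add.subgroupI)
    fix x assume x: "x \<in> I"
    have "\<ominus>\<^bsub>ring_on A\<^esub> x = - x"
      by (rule minus_equality) (use x assms(1) uminus in \<open>auto simp: ring_on_def\<close>)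
    moreover have "- x \<in> I" using assms(4)[OF uminus[OF one] x] by simp
    ultimately show "\<ominus>\<^bsub>ring_on A\<^esub> x \<in> I" by simp
  qed (use assms in \<open>auto simp: ring_on_def\<close>)
  fix a x assume "a \<in> I" "x \<in> carrier (ring_on A)"
  then have "x * a \<in> I" using assms(4) by (simp add: ring_on_def)
  then show "x \<otimes>\<^bsub>ring_on A\<^esub> a \<in> I" "a \<otimes>\<^bsub>ring_on A\<^esub> x \<in> I"
    by (simp_all add: ring_on_def mult.commute[of a])
qed

end

lemma subring_set_UNIV: "subring_set UNIV"
  by unfold_locales auto

lemma polys_in_iff:
  "p \<in> polys_in d A \<longleftrightarrow>
    (\<forall>m\<in>Poly_Mapping.keys p. Poly_Mapping.keys m \<subseteq> {..<d}) \<and> (\<forall>m. Poly_Mapping.lookup p m \<in> A)"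
  by (auto simp: polys_in_def)

lemma single_in_polys_in:
  "0 \<in> A \<Longrightarrow> Poly_Mapping.keys m \<subseteq> {..<d} \<Longrightarrow> c \<in> A \<Longrightarrow> Poly_Mapping.single m c \<in> polys_in d A"
  by (auto simp: polys_in_iff lookup_single when_def split: if_splits)

text \<open>An arbitrary subring of coefficients is allowed in order to apply this twice, for
  \<open>R\<close> and then for \<open>R[T]\<close>.\<close>

lemma subring_set_polys_in:
  assumes "subring_set (A :: 'a::comm_ring_1 set)"
  shows "subring_set (polys_in d A)"
proof -
  interpret subring_set A by (rule assms)
  have add': "p + q \<in> polys_in d A" if "p \<in> polys_in d A" "q \<in> polys_in d A" for p q
    using that keys_add[of p q] by (auto simp: polys_in_iff lookup_add intro!: add) blast+
  have 0: "0 \<in> polys_in d A" by (simp add: polys_in_iff)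
  have sum': "sum f I \<in> polys_in d A" if "\<And>i. i \<in> I \<Longrightarrow> f i \<in> polys_in d A"
    for I :: "(nat \<Rightarrow>\<^sub>0 nat) set" and f
    using that by (induction I rule: infinite_finite_induct) (auto intro: add' 0)
  show ?thesis
  proof
    show "1 \<in> polys_in d A" using single_in_polys_in[of A 0 d 1] by simp
    show "- p \<in> polys_in d A" if "p \<in> polys_in d A" for p
      using that by (auto simp: polys_in_iff uminus)
    fix p q assume pq: "p \<in> polys_in d A" "q \<in> polys_in d A"
    show "p + q \<in> polys_in d A" using pq by (rule add')
    let ?s = "\<lambda>p m. Poly_Mapping.single m (Poly_Mapping.lookup p m)"
    have "p * q = (\<Sum>m\<in>Poly_Mapping.keys p. ?s p m) * (\<Sum>m\<in>Poly_Mapping.keys q. ?s q m)"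
      by (simp only: sum_single_lookup)
    also have "\<dots> = (\<Sum>m\<in>Poly_Mapping.keys p. \<Sum>m'\<in>Poly_Mapping.keys q.
        Poly_Mapping.single (m + m') (Poly_Mapping.lookup p m * Poly_Mapping.lookup q m'))"
      by (simp add: sum_product mult_single)
    also have "\<dots> \<in> polys_in d A"
    proof (intro sum' single_in_polys_in zero mult)
      fix m m' assume "m \<in> Poly_Mapping.keys p" "m' \<in> Poly_Mapping.keys q"
      then have "Poly_Mapping.keys m \<subseteq> {..<d}" "Poly_Mapping.keys m' \<subseteq> {..<d}"
        using pq by (auto simp: polys_in_iff)
      then show "Poly_Mapping.keys (m + m') \<subseteq> {..<d}" using keys_add[of m m'] by blast
    qed (use pq in \<open>auto simp: polys_in_iff\<close>)
    finally show "p * q \<in> polys_in d A" .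
  qed
qed

abbreviation sym_carrier :: "nat \<Rightarrow> nat \<Rightarrow> 'k::field mpol mpol set"
  where "sym_carrier n r \<equiv> polys_in r (polys_in n UNIV)"

lemma subring_set_base: "subring_set (polys_in n UNIV :: 'k::field mpol set)"
  by (intro subring_set_polys_in subring_set_UNIV)

lemma subring_set_sym: "subring_set (sym_carrier n r :: 'k::field mpol mpol set)"
  by (intro subring_set_polys_in subring_set_UNIV)

lemma incl_T_in_sym:
  assumes "p \<in> polys_in r (UNIV :: 'k::field set)"
  shows "incl_T p \<in> sym_carrier n r"
proof -
  interpret subring_set "polys_in n UNIV :: 'k mpol set" by (rule subring_set_base)
  have "Poly_Mapping.keys (incl_T p) \<subseteq> Poly_Mapping.keys p"
    by (auto simp: in_keys_iff lookup_incl_T const.hom_zero)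
  moreover have "const c \<in> polys_in n UNIV" for c :: 'k
    unfolding const_def by (rule single_in_polys_in) auto
  ultimately show ?thesis using assms by (auto simp: polys_in_iff[of _ r] lookup_incl_T)
qed

lemma rees_ideal_eq:
  "rees_ideal n es = {P \<in> sym_carrier n (length es). rees_map (\<lambda>i. edge_mono (es ! i)) P = 0}"
  by (simp add: rees_ideal_def a_kernel_def' sym_ring_def rees_algebra_def ring_on_def)

lemma ideal_rees_ideal:
  "ideal (rees_ideal n es :: 'k::field mpol mpol set) (sym_ring n (length es))"
proof -
  interpret subring_set "sym_carrier n (length es) :: 'k mpol mpol set" by (rule subring_set_sym)
  show ?thesis unfolding sym_ring_def rees_ideal_eq
    by (rule ideal_ring_onI) (auto simp: add mult rees_map.hom_add rees_map.hom_mult)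
qed

section \<open>Monomials of the symmetric ring\<close>

definition xT_mono :: "nat multiset \<Rightarrow> nat multiset \<Rightarrow> 'k::field mpol mpol"
  where "xT_mono A U = Poly_Mapping.single (exps U) (mono (exps A))"

lemma xT_mono_mult: "xT_mono A U * xT_mono B V = xT_mono (A + B) (U + V)"
  by (simp add: xT_mono_def mult_single mono_mult)

lemma xT_mono_in_sym:
  assumes "set_mset A \<subseteq> {..<n}" and "set_mset U \<subseteq> {..<r}"
  shows "(xT_mono A U :: 'k::field mpol mpol) \<in> sym_carrier n r"
proof -
  interpret subring_set "polys_in n UNIV :: 'k mpol set" by (rule subring_set_base)
  show ?thesis unfolding xT_mono_def mono_def
    using assms by (intro single_in_polys_in) auto
qed

lemma incl_T_mono: "incl_T (mono (exps U)) = xT_mono {#} U"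
  by (simp add: mono_def xT_mono_def const_def)

text \<open>Monomials go to monomials, so two of them have the same image exactly when their total
  vertex degrees and their numbers of edges agree.\<close>

lemma rees_map_xT_mono:
  "rees_map (\<lambda>i. edge_mono (es ! i)) (xT_mono A U :: 'k::field mpol mpol) =
    Polynomial.monom (mono (exps (A + (\<Sum>i\<in>#U. mset_set (es ! i))))) (size U)"
proof (induction U)
  case (add i U)
  have "(xT_mono A (add_mset i U) :: 'k mpol mpol) = xT_mono A U * xT_mono {#} {#i#}"
    by (simp add: xT_mono_mult)
  moreover have "rees_map (\<lambda>i. edge_mono (es ! i)) (xT_mono {#} {#i#} :: 'k mpol mpol) =
      Polynomial.monom (edge_mono (es ! i)) 1"
    using rees_term_exps[of "\<lambda>i. edge_mono (es ! i)" "{#i#}"] by (simp add: xT_mono_def)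
  ultimately show ?case
    using add by (simp add: rees_map.hom_mult mult_monom edge_mono_def edge_exp_eq mono_mult ac_simps)
qed (simp add: xT_mono_def monom_0)

lemma var_eq: "var i = mono (exps {#i#})"
  by (simp add: var_def)

section \<open>The Taylor matrix and its Jacobian dual\<close>

lemma set_pairs: "set (pairs r) = {(j, k). j < k \<and> k < r}"
  by (auto simp: pairs_def image_iff)

lemma mset_set_Diff':
  "finite e \<Longrightarrow> finite f \<Longrightarrow> mset_set e - mset_set f = mset_set (e - f)"
  by (rule multiset_eqI) (auto simp: count_mset_set')

lemma exps_diff: "exps A - exps B = exps (A - B)"
  by (rule poly_mapping_eqI) (simp add: lookup_minus)

lemma exp_lcm_diff: "exp_lcm u v - u = v - u" "exp_lcm u v - v = u - v"
  by (rule poly_mapping_eqI; simp add: exp_lcm_def lookup_minus lookup_add)+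

text \<open>Edge monomials are squarefree, so dividing the lcm of two of them by one leaves the
  product of the variables in a difference of the two edges.\<close>

lemma T_row_taylor:
  fixes es :: "nat set list"
  assumes fin: "\<And>e. e \<in> set es \<Longrightarrow> finite e"
    and c: "c < length (pairs (length es))" and jk: "pairs (length es) ! c = (j, k)"
  shows "(T_row_mult (taylor_mat es) :: 'k::field mpol mpol mat) $$ (0, c) =
    xT_mono (mset_set (es ! j - es ! k)) {#k#} - xT_mono (mset_set (es ! k - es ! j)) {#j#}"
proof -
  let ?r = "length es" and ?\<phi> = "taylor_mat es :: 'k mpol mat"
  have "(j, k) \<in> set (pairs ?r)" using c jk by (metis nth_mem)
  then have jk': "j < k" "k < ?r" by (auto simp: set_pairs)
  have dims: "dim_row ?\<phi> = ?r" "dim_col ?\<phi> = length (pairs ?r)" by (simp_all add: taylor_mat_def)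
  let ?f = "\<lambda>i. var i * const (?\<phi> $$ (i, c)) :: 'k mpol mpol"
  have "(T_row_mult ?\<phi>) $$ (0, c) = (\<Sum>i = 0..<?r. ?f i)"
    using c dims by (simp add: T_row_mult_def scalar_prod_def)
  also have "\<dots> = (\<Sum>i\<in>{j, k}. ?f i)"
    by (rule sum.mono_neutral_right)
      (use jk' jk c in \<open>auto simp: taylor_mat_def Let_def const.hom_zero\<close>)
  also have "\<dots> = ?f j + ?f k" using jk' by simp
  also have "?f j = - xT_mono (mset_set (es ! k - es ! j)) {#j#}"
    using jk' jk c fin
    by (simp add: taylor_mat_def Let_def exp_lcm_diff edge_exp_eq exps_diff mset_set_Diff'
        const.hom_uminus var_eq xT_mono_def mono_def const_def mult_single single_uminus)
  also have "?f k = xT_mono (mset_set (es ! j - es ! k)) {#k#}"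
    using jk' jk c fin
    by (simp add: taylor_mat_def Let_def exp_lcm_diff edge_exp_eq exps_diff mset_set_Diff'
        var_eq xT_mono_def mono_def const_def mult_single)
  finally show ?thesis by simp
qed

text \<open>The entry of the reduced Jacobian dual in row \<open>i\<close> and the column of the
  pair \<open>p\<close>. A coefficient of the Taylor relation contributes only if it is a single
  variable, that is, if the two edges share a vertex; for disjoint edges it is quadratic and
  vanishes after reduction.\<close>

definition dual_entry :: "nat set list \<Rightarrow> nat \<Rightarrow> nat \<times> nat \<Rightarrow> 'k::field mpol"
  where "dual_entry es i p =
    (if es ! fst p - es ! snd p = {i} then var (snd p) else 0) -
    (if es ! snd p - es ! fst p = {i} then var (fst p) else 0)"

lemma lookup_const_mult:
  "Poly_Mapping.lookup (const a * Q) m = a * Poly_Mapping.lookup Q m"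
proof -
  have "const a * Q = Poly_Mapping.map ((*) a) Q"
    by (simp add: mult_map_scale_conv_mult const_def)
  then show ?thesis by (simp add: map.rep_eq when_def)
qed

lemma lookup_var_mult:
  "Poly_Mapping.lookup (var i' * (q :: 'k::field mpol)) (Poly_Mapping.single i 1) =
    (if i' = i then Poly_Mapping.lookup q 0 else 0)"
proof -
  have shift: "Poly_Mapping.single i' 1 + m = Poly_Mapping.single i (1::nat) \<longleftrightarrow> i' = i \<and> m = 0"
    for m :: "nat \<Rightarrow>\<^sub>0 nat"
  proof
    assume eq: "Poly_Mapping.single i' 1 + m = Poly_Mapping.single i (1::nat)"
    have "Poly_Mapping.lookup (Poly_Mapping.single i' 1 + m) i' =
      Poly_Mapping.lookup (Poly_Mapping.single i (1::nat)) i'" by (simp only: eq)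
    then have "i' = i" by (auto simp: lookup_add lookup_single when_def split: if_splits)
    then show "i' = i \<and> m = 0" using eq by simp
  qed auto
  have "var i' * q = var i' * (\<Sum>m\<in>Poly_Mapping.keys q. Poly_Mapping.single m (Poly_Mapping.lookup q m))"
    by (simp only: sum_single_lookup)
  also have "\<dots> = (\<Sum>m\<in>Poly_Mapping.keys q. Poly_Mapping.single (Poly_Mapping.single i' 1 + m) (Poly_Mapping.lookup q m))"
    by (simp add: var_def mono_def sum_distrib_left mult_single)
  finally show ?thesis
    by (auto simp: lookup_sum lookup_single shift when_def in_keys_iff simp del: One_nat_def)
qed

text \<open>Comparing the coefficients of \<open>x_i T_l\<close> in the defining equation of
  \<open>B\<close> isolates the constant term of the coefficient of \<open>T_l\<close> in
  \<open>B $$ (i, c)\<close>, whatever \<open>B\<close> was chosen. Exponents other than those of a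
  single \<open>T_l\<close> do not occur, by linearity.\<close>

lemma reduced_dual_entry:
  fixes B :: "'k::field mpol mpol mat"
  assumes fin: "\<And>e. e \<in> set es \<Longrightarrow> finite e" and dual: "jacobian_dual n (taylor_mat es) B"
    and i: "i < n" and c: "c < length (pairs (length es))"
  shows "reduce (B $$ (i, c)) = dual_entry es i (pairs (length es) ! c)"
proof (rule poly_mapping_eqI)
  fix m
  obtain j k where jk: "pairs (length es) ! c = (j, k)" by force
  have "(j, k) \<in> set (pairs (length es))" using c jk by (metis nth_mem)
  then have jk': "j < k" "k < length es" by (auto simp: set_pairs)
  have cols: "dim_col (taylor_mat es :: 'k mpol mat) = length (pairs (length es))"
    by (simp add: taylor_mat_def)
  have B: "B \<in> carrier_mat n (length (pairs (length es)))"
    and lin: "\<And>P. P \<in> elements_mat B \<Longrightarrow> T_linear n (dim_row (taylor_mat es :: 'k mpol mat)) P"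
    and eq: "T_row_mult (taylor_mat es) = mat 1 n (\<lambda>(_, i). const (var i)) * B"
    using dual by (auto simp: jacobian_dual_def cols)
  have red: "Poly_Mapping.lookup (reduce P) m = Poly_Mapping.lookup (Poly_Mapping.lookup P m) 0"
    for P :: "'k mpol mpol" by (simp add: reduce_def map.rep_eq when_def)
  show "Poly_Mapping.lookup (reduce (B $$ (i, c))) m =
    Poly_Mapping.lookup (dual_entry es i (pairs (length es) ! c)) m"
  proof (cases "\<exists>l. m = Poly_Mapping.single l 1")
    case True
    then obtain l where l: "m = Poly_Mapping.single l 1" by blast
    have "T_row_mult (taylor_mat es) $$ (0, c) = (\<Sum>i' = 0..<n. const (var i') * B $$ (i', c))"
      using c B by (simp add: eq scalar_prod_def)
    then have "Poly_Mapping.lookup (Poly_Mapping.lookup (T_row_mult (taylor_mat es) $$ (0, c)) m)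
        (Poly_Mapping.single i 1) = (\<Sum>i' = 0..<n. if i' = i then
        Poly_Mapping.lookup (Poly_Mapping.lookup (B $$ (i', c)) m) 0 else 0)"
      by (simp add: lookup_sum lookup_const_mult lookup_var_mult del: One_nat_def)
    also have "\<dots> = Poly_Mapping.lookup (reduce (B $$ (i, c))) m"
      using i by (simp add: red)
    finally have "Poly_Mapping.lookup (reduce (B $$ (i, c))) m =
      Poly_Mapping.lookup (Poly_Mapping.lookup (T_row_mult (taylor_mat es) $$ (0, c)) m)
        (Poly_Mapping.single i 1)" by simp
    also have "T_row_mult (taylor_mat es) $$ (0, c) =
      (xT_mono (mset_set (es ! j - es ! k)) {#k#} - xT_mono (mset_set (es ! k - es ! j)) {#j#} :: 'k mpol mpol)"
      by (rule T_row_taylor[OF fin c jk])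
    finally have 1: "Poly_Mapping.lookup (reduce (B $$ (i, c))) m =
      Poly_Mapping.lookup (Poly_Mapping.lookup
        (xT_mono (mset_set (es ! j - es ! k)) {#k#} - xT_mono (mset_set (es ! k - es ! j)) {#j#}) m)
        (Poly_Mapping.single i 1)" .
    have ei: "Poly_Mapping.single i (1::nat) = exps {#i#}" and el: "m = exps {#l#}" for i
      by (simp_all add: l)
    have ms: "mset_set (a - b) = {#i#} \<longleftrightarrow> a - b = {i}" if "a \<in> set es" for a b
    proof
      assume "mset_set (a - b) = {#i#}"
      then have "set_mset (mset_set (a - b)) = {i}" by simp
      then show "a - b = {i}" using fin[OF that] by simp
    qed simp
    show ?thesis
      using jk' unfolding 1 unfolding jk ei el
      by (simp add: xT_mono_def lookup_minus lookup_single when_def mono_def dual_entry_def var_eq ms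
          del: exps_simps)
  next
    case False
    have "Poly_Mapping.lookup (B $$ (i, c)) m = 0"
    proof (rule ccontr)
      assume "Poly_Mapping.lookup (B $$ (i, c)) m \<noteq> 0"
      moreover have "B $$ (i, c) \<in> elements_mat B" using B i c by auto
      ultimately show False using lin False by (force simp: T_linear_def in_keys_iff)
    qed
    moreover have "Poly_Mapping.lookup (var l :: 'k mpol) m = 0" for l
      using False by (auto simp: var_def mono_def lookup_single when_def)
    ultimately show ?thesis by (simp add: red dual_entry_def lookup_minus)
  qed
qed

section \<open>Minors of the reduced Jacobian dual\<close>

text \<open>The restriction of the Rees map to \<open>k[T]\<close>. Its kernel is the toric ideal of
  the edges, and its image is a copy of the special fiber ring.\<close>

definition fiber_map :: "nat set list \<Rightarrow> 'k::field mpol \<Rightarrow> 'k mpol poly"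
  where "fiber_map es p = rees_map (\<lambda>i. edge_mono (es ! i)) (incl_T p)"

global_interpretation fiber_map: comm_ring_hom "fiber_map es :: 'k::field mpol \<Rightarrow> _" for es
  by unfold_locales
    (simp_all add: fiber_map_def incl_T.hom_add incl_T.hom_mult rees_map.hom_add rees_map.hom_mult
      incl_T.hom_zero incl_T.hom_one rees_map.hom_zero rees_map.hom_one)

lemma fiber_map_mono:
  "fiber_map es (mono (exps U) :: 'k::field mpol) =
    Polynomial.monom (mono (exps (\<Sum>i\<in>#U. mset_set (es ! i)))) (size U)"
  by (simp add: fiber_map_def incl_T_mono rees_map_xT_mono)

lemma fiber_map_var:
  "fiber_map es (var j :: 'k::field mpol) = Polynomial.monom (mono (exps (mset_set (es ! j)))) 1"
  unfolding var_eq fiber_map_mono by simp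

text \<open>In the Rees algebra, the rows weighted by their vertices add up to zero in every column
  that has both of its nonzero entries.\<close>

lemma fiber_map_det_balanced:
  assumes M: "(M :: 'k::field mpol mat) \<in> carrier_mat t t" and t: "0 < t"
    and \<rho>: "inj_on \<rho> {..<t}"
    and entries: "\<And>i j. i < t \<Longrightarrow> j < t \<Longrightarrow> M $$ (i, j) = dual_entry es (\<rho> i) (\<gamma> j)"
    and fin: "\<And>e. e \<in> set es \<Longrightarrow> finite e"
    and \<gamma>: "\<And>j. j < t \<Longrightarrow> fst (\<gamma> j) < length es \<and> snd (\<gamma> j) < length es"
    and bal: "\<And>j. j < t \<Longrightarrow> \<exists>b c. b \<in> \<rho> ` {..<t} \<and> c \<in> \<rho> ` {..<t} \<and>
      es ! fst (\<gamma> j) - es ! snd (\<gamma> j) = {b} \<and> es ! snd (\<gamma> j) - es ! fst (\<gamma> j) = {c}"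
  shows "fiber_map es (det M) = 0"
proof -
  define N where "N = map_mat (fiber_map es) M"
  define w :: "'k mpol poly vec" where "w = Matrix.vec t (\<lambda>i. [:var (\<rho> i):])"
  have N: "N \<in> carrier_mat t t" using M by (simp add: N_def)
  have "transpose_mat N *\<^sub>v w = 0\<^sub>v t"
  proof (rule eq_vecI)
    fix j assume "j < dim_vec (0\<^sub>v t :: 'k mpol poly vec)"
    then have j: "j < t" by simp
    obtain a a' where a: "\<gamma> j = (a, a')" by force
    obtain b c where b: "b \<in> \<rho> ` {..<t}" "es ! a - es ! a' = {b}"
      and c: "c \<in> \<rho> ` {..<t}" "es ! a' - es ! a = {c}" using bal[OF j] a by auto
    have lt: "a < length es" "a' < length es" using \<gamma>[OF j] a by auto
    have neq: "b \<noteq> c" using b(2) c(2) by blast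
    let ?f = "\<lambda>v. fiber_map es (dual_entry es v (a, a')) * [:var v:] :: 'k mpol poly"
    \<comment> \<open>Either edge, completed by the vertex it lacks, gives the union of the two.
      This is why the two weighted entries of the column cancel.\<close>
    have ms: "mset_set (es ! a) + {#c#} = mset_set (es ! a') + {#b#}"
    proof (rule multiset_eqI)
      fix x
      have "x \<in> es ! a \<and> x \<notin> es ! a' \<longleftrightarrow> x = b" "x \<in> es ! a' \<and> x \<notin> es ! a \<longleftrightarrow> x = c"
        using b(2) c(2) by auto
      then show "count (mset_set (es ! a) + {#c#}) x = count (mset_set (es ! a') + {#b#}) x"
        using fin lt by (auto simp: count_mset_set')
    qed
    have mul: "Polynomial.monom p (Suc 0) * [:q:] = Polynomial.monom (p * q) (Suc 0)" for p q :: "'k mpol"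
      using mult_monom[of p "Suc 0" q 0] by (simp add: monom_0)
    have "(transpose_mat N *\<^sub>v w) $ j = (\<Sum>i = 0..<t. N $$ (i, j) * [:var (\<rho> i):])"
      using N j by (simp add: scalar_prod_def w_def)
    also have "\<dots> = (\<Sum>i = 0..<t. ?f (\<rho> i))"
      using M j by (intro sum.cong) (auto simp: N_def entries a)
    also have "\<dots> = (\<Sum>v\<in>\<rho> ` {..<t}. ?f v)"
      using \<rho> by (simp add: sum.reindex lessThan_atLeast0)
    also have "\<dots> = (\<Sum>v\<in>{b, c}. ?f v)"
      by (rule sum.mono_neutral_right) (use b c in \<open>auto simp: dual_entry_def fiber_map.hom_zero\<close>)
    also have "\<dots> = fiber_map es (var a') * [:var b:] - fiber_map es (var a) * [:var c:]"
      using neq by (simp add: dual_entry_def b(2) c(2) fiber_map.hom_uminus)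
    also have "\<dots> = 0"
      unfolding fiber_map_var One_nat_def mul unfolding var_eq mono_mult exps_simps(3)[symmetric] ms
      by simp
    finally show "(transpose_mat N *\<^sub>v w) $ j = 0\<^sub>v t $ j" using j by simp
  qed (use N in simp)
  moreover have "w \<noteq> 0\<^sub>v t"
  proof
    assume "w = 0\<^sub>v t"
    then have "w $ 0 = 0" using t by simp
    then show False using t by (simp add: w_def var_def)
  qed
  moreover have "w \<in> carrier_vec t" by (simp add: w_def)
  ultimately have "det (transpose_mat N) = 0"
    using det_0_iff_vec_prod_zero[of "transpose_mat N" t] N by auto
  then show ?thesis
    using det_transpose[OF N] by (simp add: N_def)
qed

text \<open>An unbalanced column has at most one nonzero entry, so that Laplace expansion reduces to
  the balanced case.\<close>

lemma fiber_map_det_or_mono: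
  assumes "(M :: 'k::field mpol mat) \<in> carrier_mat t t" and "inj_on \<rho> {..<t}"
    and "\<And>i j. i < t \<Longrightarrow> j < t \<Longrightarrow> M $$ (i, j) = dual_entry es (\<rho> i) (\<gamma> j)"
    and card: "\<And>e. e \<in> set es \<Longrightarrow> card e = 2"
    and "\<And>j. j < t \<Longrightarrow> fst (\<gamma> j) < length es \<and> snd (\<gamma> j) < length es"
  shows "fiber_map es (det M) = 0 \<or> (\<exists>w. det M = mono w \<or> det M = - mono w)"
  using assms(1-3,5)
proof (induction t arbitrary: M \<rho> \<gamma>)
  case 0
  then have "det M = mono 0" by simp
  then show ?case by blast
next
  case (Suc t)
  have fin: "finite e" if "e \<in> set es" for e using card[OF that] by (simp add: card_ge_0_finite)
  show ?case
  proof (cases "\<forall>j < Suc t. \<exists>b c. b \<in> \<rho> ` {..<Suc t} \<and> c \<in> \<rho> ` {..<Suc t} \<and>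
      es ! fst (\<gamma> j) - es ! snd (\<gamma> j) = {b} \<and> es ! snd (\<gamma> j) - es ! fst (\<gamma> j) = {c}")
    case True
    then have "fiber_map es (det M) = 0"
      by (intro fiber_map_det_balanced[OF Suc.prems(1) _ Suc.prems(2,3) fin Suc.prems(4)]) auto
    then show ?thesis by blast
  next
    case False
    then obtain j where j: "j < Suc t"
      and unbal: "\<nexists>b c. b \<in> \<rho> ` {..<Suc t} \<and> c \<in> \<rho> ` {..<Suc t} \<and>
        es ! fst (\<gamma> j) - es ! snd (\<gamma> j) = {b} \<and> es ! snd (\<gamma> j) - es ! fst (\<gamma> j) = {c}"
      by blast
    obtain a a' where a: "\<gamma> j = (a, a')" by force
    have lt: "a < length es" "a' < length es" using Suc.prems(4)[OF j] a by auto
    let ?e = "es ! a" and ?f = "es ! a'"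
    \<comment> \<open>Both edges have two vertices, so their differences have the same size.\<close>
    have one: "(\<exists>b. ?e - ?f = {b}) \<longleftrightarrow> (\<exists>c. ?f - ?e = {c})"
    proof -
      have "card (?e - ?f) = card (?f - ?e)"
        using card[of ?e] card[of ?f] fin[of ?e] fin[of ?f] lt
        by (metis card_Diff_subset_Int Int_commute finite_Int nth_mem)
      then show ?thesis by (metis card_1_singleton_iff One_nat_def)
    qed
    \<comment> \<open>If neither difference is a single vertex, the column is zero and
      \<open>i0\<close> is arbitrary. Otherwise only the rows of \<open>b\<close> and
      \<open>c\<close> could be nonzero, and one of these two vertices is not among the
      rows.\<close>
    have "\<exists>i0 < Suc t. \<forall>i < Suc t. i \<noteq> i0 \<longrightarrow> M $$ (i, j) = 0"
    proof (cases "\<exists>b. ?e - ?f = {b}")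
      case True
      then obtain b c where bc: "?e - ?f = {b}" "?f - ?e = {c}" using one by blast
      then have "b \<noteq> c" by blast
      have "\<exists>v. \<forall>i < Suc t. \<rho> i \<noteq> v \<longrightarrow> M $$ (i, j) = 0"
      proof (cases "b \<in> \<rho> ` {..<Suc t}")
        case True
        then have "c \<notin> \<rho> ` {..<Suc t}" using unbal bc a by auto
        then show ?thesis
          using bc j by (intro exI[of _ b]) (auto simp: Suc.prems(3) a dual_entry_def)
      next
        case False
        then show ?thesis
          using bc j by (intro exI[of _ c]) (auto simp: Suc.prems(3) a dual_entry_def)
      qed
      then obtain v where v: "\<And>i. i < Suc t \<Longrightarrow> \<rho> i \<noteq> v \<Longrightarrow> M $$ (i, j) = 0" by blast
      show ?thesis
      proof (cases "v \<in> \<rho> ` {..<Suc t}")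
        case True
        then obtain i0 where i0: "i0 < Suc t" "v = \<rho> i0" by auto
        then have "\<rho> i \<noteq> v" if "i < Suc t" "i \<noteq> i0" for i
          using that Suc.prems(2) by (auto simp: inj_on_def)
        then show ?thesis using v i0 by blast
      next
        case False
        then show ?thesis using v by blast
      qed
    next
      case False
      then have "\<not> (\<exists>c. ?f - ?e = {c})" using one by blast
      then show ?thesis
        using False j by (intro exI[of _ 0]) (auto simp: Suc.prems(3) a dual_entry_def)
    qed
    then obtain i0 where i0: "i0 < Suc t" and zero: "\<And>i. i < Suc t \<Longrightarrow> i \<noteq> i0 \<Longrightarrow> M $$ (i, j) = 0"
      by blast
    let ?M' = "mat_delete M i0 j"
    have "det M = (\<Sum>i<Suc t. M $$ (i, j) * cofactor M i j)"
      by (rule laplace_expansion_column[OF Suc.prems(1) j])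
    also have "\<dots> = (\<Sum>i\<in>{i0}. M $$ (i, j) * cofactor M i j)"
      by (rule sum.mono_neutral_right) (use i0 zero in auto)
    finally have det: "det M = M $$ (i0, j) * ((-1) ^ (i0 + j) * det ?M')"
      by (simp add: cofactor_def)
    let ?skip = "\<lambda>i0 i. if i < i0 then i else Suc i"
    have M': "?M' \<in> carrier_mat t t" using mat_delete_carrier[OF Suc.prems(1)] by simp
    have nth': "?M' $$ (i, l) = dual_entry es ((\<rho> \<circ> ?skip i0) i) ((\<gamma> \<circ> ?skip j) l)"
      if "i < t" "l < t" for i l
      using that Suc.prems(1) by (auto simp: mat_delete_def Suc.prems(3))
    have inj': "inj_on (\<rho> \<circ> ?skip i0) {..<t}"
    proof (rule comp_inj_on)
      show "inj_on (?skip i0) {..<t}" by (auto simp: inj_on_def split: if_splits)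
      show "inj_on \<rho> (?skip i0 ` {..<t})"
        by (rule inj_on_subset[OF Suc.prems(2)]) auto
    qed
    have IH: "fiber_map es (det ?M') = 0 \<or> (\<exists>w. det ?M' = mono w \<or> det ?M' = - mono w)"
      by (rule Suc.IH[OF M' inj' nth']) (use Suc.prems(4) in auto)
    have sgn: "(-1) ^ (i0 + j) = (1 :: 'k mpol) \<or> (-1) ^ (i0 + j) = (-1 :: 'k mpol)"
      by (metis neg_one_even_power neg_one_odd_power)
    have "M $$ (i0, j) = 0 \<or> M $$ (i0, j) = var a' \<or> M $$ (i0, j) = - var a"
      using i0 j by (auto simp: Suc.prems(3) a dual_entry_def)
    \<comment> \<open>The sign of the entry and that of the cofactor are merged into
      \<open>s\<close>, which leaves a variable times a smaller minor of the same kind.\<close>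
    then consider "det M = 0" | s :: "'k mpol" and l where "s = 1 \<or> s = -1" "det M = s * (var l * det ?M')"
    proof (elim disjE)
      assume h: "M $$ (i0, j) = var a'"
      show ?thesis by (rule that(2)[OF sgn, of a']) (simp add: det h)
    next
      assume h: "M $$ (i0, j) = - var a"
      show ?thesis
        by (rule that(2)[of "- ((-1) ^ (i0 + j))" a]) (use sgn in \<open>auto simp: det h\<close>)
    qed (use det in simp)
    then show ?thesis
    proof cases
      case 1
      then show ?thesis by (simp add: fiber_map.hom_zero)
    next
      case 2
      from IH show ?thesis
      proof
        assume "fiber_map es (det ?M') = 0"
        then show ?thesis unfolding 2(2) by (simp add: fiber_map.hom_mult)
      next
        assume "\<exists>w. det ?M' = mono w \<or> det ?M' = - mono w"
        then obtain w where "det ?M' = mono w \<or> det ?M' = - mono w" by blast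
        then have "var l * det ?M' = mono (Poly_Mapping.single l 1 + w) \<or>
            var l * det ?M' = - mono (Poly_Mapping.single l 1 + w)"
          by (auto simp: var_def mono_mult)
        then show ?thesis using 2(1) unfolding 2(2) by (metis mult_1 mult_minus1 minus_minus)
      qed
    qed
  qed
qed

text \<open>Two distinct monomials give two nonzero coefficients. This excludes the second
  alternative of \<open>fiber_map_det_or_mono\<close> for the generators of the theorem.\<close>

lemma binomial_poly_not_mono:
  assumes "binomial_poly p"
  shows "p \<noteq> mono w" and "p \<noteq> - mono w"
proof -
  obtain u v where uv: "u \<noteq> v" "p = mono u + mono v \<or> p = mono u - mono v"
    using assms by (auto simp: binomial_poly_def)
  have "Poly_Mapping.lookup p u \<noteq> 0" "Poly_Mapping.lookup p v \<noteq> 0"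
    using uv by (auto simp: mono_def lookup_add lookup_minus lookup_single when_def)
  moreover have "Poly_Mapping.lookup (mono w :: 'a mpol) x = 0" if "x \<noteq> w" for x
    using that by (simp add: mono_def lookup_single when_def)
  ultimately show "p \<noteq> mono w" "p \<noteq> - mono w"
    using uv(1) by (metis, metis lookup_uminus neg_equal_0_iff_equal)
qed

section \<open>Binomials in the defining ideal\<close>

lemma mset_set_subseteqI:
  assumes "S \<subseteq> set_mset D"
  shows "mset_set S \<subseteq># D"
proof (rule mset_subset_eqI)
  fix x
  have "finite S" using assms finite_subset by blast
  then show "count (mset_set S) x \<le> count D x"
    using assms by (cases "x \<in> S") (auto simp: Suc_le_eq)
qed

lemma size_edge_sum:
  "(\<And>e. e \<in># U \<Longrightarrow> card e = 2) \<Longrightarrow> size (edge_sum U) = 2 * size U"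
  by (induction U) auto

text \<open>\<open>I\<close> stands for any ideal that contains the proposed generators. Showing
  that the defining ideal lies in every such \<open>I\<close> gives its inclusion in the ideal they
  generate.\<close>

locale edge_relations =
  fixes n :: nat and es :: "nat set list" and N :: "'k::field mpol mat" and I :: "'k mpol mpol set"
  assumes card_edge: "\<And>e. e \<in> set es \<Longrightarrow> card e = 2"
    and edge_bound: "\<And>e. e \<in> set es \<Longrightarrow> e \<subseteq> {..<n}"
    and dist: "distinct es"
    and ideal: "ideal I (sym_ring n (length es))"
    and taylor: "\<And>j k. j < k \<Longrightarrow> k < length es \<Longrightarrow>
      xT_mono (mset_set (es ! j - es ! k)) {#k#} - xT_mono (mset_set (es ! k - es ! j)) {#j#} \<in> I"
    and N: "N \<in> carrier_mat n (length (pairs (length es)))"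
    and N_nth: "\<And>i c. i < n \<Longrightarrow> c < length (pairs (length es)) \<Longrightarrow>
      N $$ (i, c) = dual_entry es i (pairs (length es) ! c)"
    and minor: "\<And>t p. 2 \<le> t \<Longrightarrow> t \<le> mat_rank N \<Longrightarrow> p \<in> bi t N \<Longrightarrow> incl_T p \<in> I"
begin

abbreviation r :: nat where "r \<equiv> length es"

sublocale sym: subring_set "sym_carrier n r :: 'k mpol mpol set"
  by (rule subring_set_sym)

lemma fin_edge: "e \<in> set es \<Longrightarrow> finite e"
  using card_edge[of e] by (auto intro: card_ge_0_finite)

lemmas idealD = sym.ideal_ring_onD[OF ideal[unfolded sym_ring_def]]

text \<open>The graph arguments use multisets of edges, the monomials multisets of indices of the
  \<open>T\<close> variables; \<open>pos\<close> leads from the former to the latter.\<close>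

definition pos :: "nat set \<Rightarrow> nat"
  where "pos = inv_into {..<r} ((!) es)"

lemma inj_nth: "inj_on ((!) es) {..<r}"
  using dist by (auto simp: inj_on_def nth_eq_iff_index_eq)

lemma pos_nth [simp]: "i < r \<Longrightarrow> pos (es ! i) = i"
  unfolding pos_def by (rule inv_into_f_f[OF inj_nth]) simp

lemma pos_edge:
  assumes "e \<in> set es"
  shows "pos e < r" and "es ! pos e = e"
  using assms by (auto simp: in_set_conv_nth)

lemma pos_inject: "e \<in> set es \<Longrightarrow> f \<in> set es \<Longrightarrow> pos e = pos f \<longleftrightarrow> e = f"
  by (metis pos_edge(2))

text \<open>Congruence modulo \<open>I\<close> of two monomials. It is an equivalence relation
  stable under multiplication by monomials, so rewriting one monomial into another replaces
  computing with ideal members.\<close>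

definition eqv :: "nat multiset \<Rightarrow> nat set multiset \<Rightarrow> nat multiset \<Rightarrow> nat set multiset \<Rightarrow> bool"
  where "eqv A U B V \<longleftrightarrow> xT_mono A (image_mset pos U) - xT_mono B (image_mset pos V) \<in> I"

lemma eqv_refl [simp]: "eqv A U A U"
  using idealD(2) by (simp add: eqv_def)

lemma eqv_sym: "eqv A U B V \<Longrightarrow> eqv B V A U"
  unfolding eqv_def using idealD(4)[OF sym.uminus[OF sym.one]] by fastforce

lemma eqv_trans: "eqv A U B V \<Longrightarrow> eqv B V C W \<Longrightarrow> eqv A U C W"
  unfolding eqv_def using idealD(3) by fastforce

lemma eqv_add:
  assumes "eqv A U B V" and C: "set_mset C \<subseteq> {..<n}" and W: "set_mset W \<subseteq> set es"
  shows "eqv (A + C) (U + W) (B + C) (V + W)"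
proof -
  have "xT_mono C (image_mset pos W) \<in> sym_carrier n r"
    using C W pos_edge(1) by (intro xT_mono_in_sym) auto
  then have "xT_mono C (image_mset pos W) *
      (xT_mono A (image_mset pos U) - xT_mono B (image_mset pos V)) \<in> I"
    using assms(1) unfolding eqv_def by (rule idealD(4))
  then show ?thesis
    by (simp add: eqv_def algebra_simps xT_mono_mult)
qed

text \<open>The Taylor relation as an exchange of edges, freed from their order in the list; for
  \<open>e = f\<close> it is reflexivity.\<close>

lemma taylor_eqv:
  assumes e: "e \<in> set es" and f: "f \<in> set es"
  shows "eqv (mset_set (f - e)) {#e#} (mset_set (e - f)) {#f#}"
proof -
  have *: "eqv (mset_set (f - e)) {#e#} (mset_set (e - f)) {#f#}"
    if "e \<in> set es" "f \<in> set es" "pos f < pos e" for e f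
    using taylor[OF that(3)] pos_edge that by (simp add: eqv_def)
  show ?thesis
    using *[OF e f] eqv_sym[OF *[OF f e]] pos_inject[OF e f]
    by (cases "pos e" "pos f" rule: linorder_cases) auto
qed

text \<open>The signs of the two terms of the minor need not be computed: they have to cancel under
  \<^const>\<open>fiber_map\<close>.\<close>

lemma cycle_eqv:
  assumes C: "C \<noteq> {}" and g: "bij_betw g C C"
    and min: "\<And>D. D \<subseteq> C \<Longrightarrow> D \<noteq> {} \<Longrightarrow> g ` D \<subseteq> D \<Longrightarrow> D = C"
    and eU: "\<And>a. a \<in> C \<Longrightarrow> {a, h a} \<in> set es"
    and eV: "\<And>a. a \<in> C \<Longrightarrow> {g a, h a} \<in> set es"
    and disj: "\<And>a b. a \<in> C \<Longrightarrow> b \<in> C \<Longrightarrow> {a, h a} \<noteq> {g b, h b}"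
  shows "eqv {#} {#{a, h a}. a \<in># mset_set C#} {#} {#{g a, h a}. a \<in># mset_set C#}"
proof -
  have gC: "g a \<in> C" if "a \<in> C" for a using g that by (auto dest: bij_betwE)
  have Cn: "C \<subseteq> {..<n}" using eU edge_bound by blast
  then have finC: "finite C" using finite_subset by blast
  have ne: "g a \<noteq> a" if "a \<in> C" for a using disj[OF that that] by auto
  have ha: "a \<noteq> h a" "g a \<noteq> h a" if "a \<in> C" for a
    using card_edge[OF eU[OF that]] card_edge[OF eV[OF that]] by (auto split: if_splits)
  let ?e = "\<lambda>a. {a, h a}" and ?f = "\<lambda>a. {g a, h a}"
  \<comment> \<open>Columns belong to increasing pairs of positions, so the two edges of the path
    from \<open>a\<close> through \<open>h a\<close> to \<open>g a\<close> have to be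
    sorted.\<close>
  let ?pair = "\<lambda>a. (min (pos (?e a)) (pos (?f a)), max (pos (?e a)) (pos (?f a)))"
  have "\<exists>c < length (pairs r). pairs r ! c = ?pair a" if a: "a \<in> C" for a
  proof -
    have "pos (?e a) \<noteq> pos (?f a)" using disj[OF a a] pos_inject[OF eU[OF a] eV[OF a]] by blast
    then have "?pair a \<in> set (pairs r)"
      using pos_edge(1)[OF eU[OF a]] pos_edge(1)[OF eV[OF a]] by (auto simp: set_pairs min_def max_def)
    then show ?thesis by (metis in_set_conv_nth)
  qed
  then obtain \<kappa> where \<kappa>: "\<And>a. a \<in> C \<Longrightarrow> \<kappa> a < length (pairs r)"
    and \<kappa>': "\<And>a. a \<in> C \<Longrightarrow> pairs r ! \<kappa> a = ?pair a" by metis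
  \<comment> \<open>Equal columns mean equal pairs of edges, and \<open>disj\<close> prevents them
    from matching crosswise. So \<open>{a, h a} = {b, h b}\<close> and
    \<open>{g a, h a} = {g b, h b}\<close>. For distinct \<open>a\<close> and \<open>b\<close> the
    first gives \<open>h a = b\<close> and \<open>h b = a\<close>, and then the second forces
    \<open>g a = a\<close>.\<close>
  have \<kappa>inj: "inj_on \<kappa> C"
  proof (rule inj_onI, rule ccontr)
    fix a b assume ab: "a \<in> C" "b \<in> C" "\<kappa> a = \<kappa> b" "a \<noteq> b"
    then have "?pair a = ?pair b" using \<kappa>' by metis
    then have "{pos (?e a), pos (?f a)} = {pos (?e b), pos (?f b)}"
      by (auto simp: min_def max_def split: if_splits)
    moreover have "pos (?e a) \<noteq> pos (?f b)"
      using disj ab pos_inject eU eV by blast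
    ultimately have "pos (?e a) = pos (?e b)" "pos (?f a) = pos (?f b)"
      by (auto simp: doubleton_eq_iff)
    then have "?e a = ?e b" "?f a = ?f b" using pos_inject eU eV ab by blast+
    then show False using ab ne[OF ab(1)] by (auto simp: doubleton_eq_iff)
  qed
  define t where "t = card C"
  define J where "J = \<kappa> ` C"
  have J: "J \<subseteq> {..<dim_col N}" "card J = t"
    using \<kappa> N \<kappa>inj by (auto simp: J_def t_def card_image)
  have I: "C \<subseteq> {..<dim_row N}" using Cn N by simp
  define M where "M = submatrix N C J"
  have M: "M \<in> carrier_mat t t" using submatrix_carrier[OF I J(1)] J(2) by (simp add: M_def t_def)
  define \<alpha> where "\<alpha> = pick C"
  have \<alpha>: "bij_betw \<alpha> {0..<t} C" unfolding \<alpha>_def t_def by (rule bij_betw_pick[OF finC])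
  \<comment> \<open>The vertex of \<open>C\<close> whose path gives the column in position
    \<open>j\<close> of the submatrix.\<close>
  define \<beta> where "\<beta> = inv_into C \<kappa> \<circ> pick J"
  have "bij_betw (pick J) {0..<t} J" using bij_betw_pick[of J] J(2) finC by (simp add: J_def)
  moreover have "bij_betw (inv_into C \<kappa>) J C"
    using \<kappa>inj by (simp add: J_def bij_betw_inv_into inj_on_imp_bij_betw)
  ultimately have \<beta>: "bij_betw \<beta> {0..<t} C" unfolding \<beta>_def by (rule bij_betw_trans)
  have pickJ: "pick J j \<in> J" if "j < t" for j
    using pick_in_set_le[of j J] J(2) that by simp
  have \<kappa>\<beta>: "\<kappa> (\<beta> j) = pick J j" if "j < t" for j
    using pickJ[OF that] by (simp add: \<beta>_def J_def f_inv_into_f)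
  have \<alpha>C: "\<alpha> i \<in> C" and \<beta>C: "\<beta> i \<in> C" if "i < t" for i
    using bij_betwE[OF \<alpha>] bij_betwE[OF \<beta>] that by auto
  have M_nth: "M $$ (i, j) = dual_entry es (\<alpha> i) (pairs r ! \<kappa> (\<beta> j))" if "i < t" "j < t" for i j
  proof -
    have "M $$ (i, j) = N $$ (pick C i, pick J j)"
      unfolding M_def by (rule submatrix_nth[OF I J(1)]) (use that J in \<open>auto simp: t_def\<close>)
    moreover have "\<alpha> i < n" "\<kappa> (\<beta> j) < length (pairs r)"
      using \<alpha>C[OF that(1)] \<beta>C[OF that(2)] Cn \<kappa> by auto
    ultimately show ?thesis
      using N_nth by (simp add: \<alpha>_def \<kappa>\<beta>[OF that(2)])
  qed
  have diff: "?e a - ?f a = {a}" "?f a - ?e a = {g a}" if "a \<in> C" for a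
    using ne[OF that] ha[OF that] by auto
  \<comment> \<open>The sign with which column \<open>a\<close> of the Taylor matrix was oriented:
    it depends on which of the two edges comes earlier in the list.\<close>
  define \<epsilon> :: "nat \<Rightarrow> 'k mpol" where "\<epsilon> a = (if pos (?e a) < pos (?f a) then 1 else -1)" for a
  have entry: "dual_entry es v (pairs r ! \<kappa> a) =
      (if v = a then \<epsilon> a * var (pos (?f a)) else if v = g a then - \<epsilon> a * var (pos (?e a)) else 0)"
    if a: "a \<in> C" for v a
    using ne[OF a] pos_inject[OF eU[OF a] eV[OF a]] disj[OF a a]
    by (auto simp: \<kappa>'[OF a] dual_entry_def \<epsilon>_def min_def max_def
        pos_edge(2)[OF eU[OF a]] pos_edge(2)[OF eV[OF a]] diff[OF a])
  let ?U = "{#?e a. a \<in># mset_set C#}" and ?V = "{#?f a. a \<in># mset_set C#}"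
  define mU where "mU = (mono (exps (image_mset pos ?U)) :: 'k mpol)"
  define mV where "mV = (mono (exps (image_mset pos ?V)) :: 'k mpol)"
  have prodU: "(\<Prod>a\<in>C. var (pos (?e a))) = mU" and prodV: "(\<Prod>a\<in>C. var (pos (?f a))) = mV"
    by (simp_all add: mU_def mV_def mono_exps_mset image_mset.compositionality o_def prod_unfold_prod_mset)
  have prod_sgn: "prod \<delta> C \<in> {1, -1}" if "\<And>a. a \<in> C \<Longrightarrow> \<delta> a \<in> {1, -1}" for \<delta> :: "nat \<Rightarrow> 'k mpol"
    using finC that
  proof (induction C rule: finite_induct)
    case (insert x F)
    then have "\<delta> x \<in> {1, -1}" "prod \<delta> F \<in> {1, -1}" by blast+
    then show ?case by (auto simp: insert.hyps)
  qed simp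
  have "\<exists>s1\<in>{1, -1}. \<exists>s2\<in>{1, -1}. det M =
      s1 * (\<Prod>a\<in>C. \<epsilon> a * var (pos (?f a))) + s2 * (\<Prod>a\<in>C. - \<epsilon> a * var (pos (?e a)))"
  proof (rule det_cyclic[OF M \<alpha> \<beta> C g ne min])
    fix i j assume "i < t" "j < t"
    then show "M $$ (i, j) =
        (if \<alpha> i = \<beta> j then \<epsilon> (\<beta> j) * var (pos (?f (\<beta> j)))
         else if \<alpha> i = g (\<beta> j) then - \<epsilon> (\<beta> j) * var (pos (?e (\<beta> j))) else 0)"
      by (simp only: M_nth entry[OF \<beta>C])
  qed
  then obtain s1 s2 :: "'k mpol" where s: "s1 \<in> {1, -1}" "s2 \<in> {1, -1}"
    and det0: "det M = s1 * (\<Prod>a\<in>C. \<epsilon> a * var (pos (?f a))) + s2 * (\<Prod>a\<in>C. - \<epsilon> a * var (pos (?e a)))"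
    by blast
  have sgn\<epsilon>: "prod \<epsilon> C \<in> {1, -1}" "(\<Prod>a\<in>C. - \<epsilon> a) \<in> {1, -1}"
    by (rule prod_sgn; simp add: \<epsilon>_def)+
  define s1' s2' where "s1' = s1 * prod \<epsilon> C" and "s2' = s2 * (\<Prod>a\<in>C. - \<epsilon> a)"
  have s': "s1' \<in> {1, -1}" "s2' \<in> {1, -1}"
    using s sgn\<epsilon> by (auto simp: s1'_def s2'_def)
  have det: "det M = s1' * mV + s2' * mU"
    unfolding det0 prod.distrib prodU prodV s1'_def s2'_def by (simp only: mult.assoc)
  have t0: "0 < t" using C finC by (simp add: t_def card_gt_0_iff)
  have ker: "fiber_map es (det M) = 0"
  proof (rule fiber_map_det_balanced[OF M t0 _ M_nth fin_edge])
    show "inj_on \<alpha> {..<t}" using \<alpha> by (simp add: bij_betw_def lessThan_atLeast0)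
    fix j assume j: "j < t"
    note a = \<beta>C[OF j]
    have im: "\<alpha> ` {..<t} = C" using \<alpha> by (simp add: bij_betw_def lessThan_atLeast0)
    show "fst (pairs r ! \<kappa> (\<beta> j)) < length es \<and> snd (pairs r ! \<kappa> (\<beta> j)) < length es"
      using pos_edge(1)[OF eU[OF a]] pos_edge(1)[OF eV[OF a]] by (simp add: \<kappa>'[OF a])
    show "\<exists>b c. b \<in> \<alpha> ` {..<t} \<and> c \<in> \<alpha> ` {..<t} \<and>
        es ! fst (pairs r ! \<kappa> (\<beta> j)) - es ! snd (pairs r ! \<kappa> (\<beta> j)) = {b} \<and>
        es ! snd (pairs r ! \<kappa> (\<beta> j)) - es ! fst (pairs r ! \<kappa> (\<beta> j)) = {c}"
      unfolding im \<kappa>'[OF a]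
      using diff[OF a] a gC[OF a] pos_edge(2)[OF eU[OF a]] pos_edge(2)[OF eV[OF a]]
      by (cases "pos (?e (\<beta> j)) < pos (?f (\<beta> j))") (simp_all add: min_def max_def)
  qed
  \<comment> \<open>Either family of edges contributes \<open>h a\<close> for each \<open>a\<close>,
    together with the vertices of \<open>C\<close>, in the order given by \<open>g\<close> in the
    second family. So \<open>mU\<close> and \<open>mV\<close> have the same image.\<close>
  have sumU: "(\<Sum>i\<in>#image_mset pos ?U. mset_set (es ! i)) = (\<Sum>a\<in>C. {#a#}) + (\<Sum>a\<in>C. {#h a#})"
  proof -
    have "(\<Sum>i\<in>#image_mset pos ?U. mset_set (es ! i)) = (\<Sum>a\<in>C. mset_set (es ! pos (?e a)))"
      by (simp add: image_mset.compositionality o_def sum_unfold_sum_mset)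
    also have "\<dots> = (\<Sum>a\<in>C. {#a#} + {#h a#})"
      by (rule sum.cong) (use ha pos_edge(2)[OF eU] in auto)
    finally show ?thesis by (simp only: sum.distrib)
  qed
  have sumV: "(\<Sum>i\<in>#image_mset pos ?V. mset_set (es ! i)) = (\<Sum>a\<in>C. {#a#}) + (\<Sum>a\<in>C. {#h a#})"
  proof -
    have "(\<Sum>i\<in>#image_mset pos ?V. mset_set (es ! i)) = (\<Sum>a\<in>C. mset_set (es ! pos (?f a)))"
      by (simp add: image_mset.compositionality o_def sum_unfold_sum_mset)
    also have "\<dots> = (\<Sum>a\<in>C. {#g a#} + {#h a#})"
      by (rule sum.cong) (use ha pos_edge(2)[OF eV] in auto)
    also have "\<dots> = (\<Sum>a\<in>C. {#g a#}) + (\<Sum>a\<in>C. {#h a#})" by (simp only: sum.distrib)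
    also have "(\<Sum>a\<in>C. {#g a#}) = (\<Sum>a\<in>C. {#a#})" by (rule sum.reindex_bij_betw[OF g])
    finally show ?thesis .
  qed
  obtain w d where fU: "fiber_map es mU = Polynomial.monom (mono w) d"
    and fV: "fiber_map es mV = Polynomial.monom (mono w) d"
    unfolding mU_def mV_def fiber_map_mono sumU sumV by (simp add: that)
  \<comment> \<open>With equal signs the vanishing of the image says that twice a monomial is zero.
    Then \<open>1 + 1 = 0\<close> in the field, and every monomial equals its negative.\<close>
  have two: "mono v + mono v = (0 :: 'k mpol)" if "fiber_map es mV + fiber_map es mU = 0" for v
  proof -
    have "mono w + mono w = (0 :: 'k mpol)" using that by (simp add: fU fV add_monom)
    then have "Poly_Mapping.lookup (mono w :: 'k mpol) w + Poly_Mapping.lookup (mono w) w = 0"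
      by (simp only: lookup_add[symmetric] lookup_zero)
    then have "1 + 1 = (0 :: 'k)" by (simp only: mono_def lookup_single_eq)
    then show ?thesis by (simp add: mono_def flip: single_add)
  qed
  have minus: "- mU = mU" if "fiber_map es mV + fiber_map es mU = 0"
    using two[OF that, of "exps (image_mset pos ?U)"] by (simp add: mU_def minus_unique)
  have minus': "- mV = mV" if "fiber_map es mV + fiber_map es mU = 0"
    using two[OF that, of "exps (image_mset pos ?V)"] by (simp add: mV_def minus_unique)
  have sgn: "det M = mV - mU \<or> det M = mU - mV"
  proof -
    have "(s1' = 1 \<or> s1' = -1) \<and> (s2' = 1 \<or> s2' = -1)" using s' by auto
    then consider "s1' = 1" "s2' = 1" | "s1' = 1" "s2' = -1" | "s1' = -1" "s2' = 1" | "s1' = -1" "s2' = -1"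
      by blast
    then show ?thesis
    proof cases
      case 1
      then have d: "det M = mV + mU" by (simp add: det)
      then have "fiber_map es mV + fiber_map es mU = 0" using ker by (simp add: fiber_map.hom_add)
      then have "det M = mV - mU" using minus by (metis d diff_conv_add_uminus)
      then show ?thesis ..
    next
      case 4
      then have d: "det M = - (mV + mU)" by (simp add: det)
      then have "fiber_map es (- (mV + mU)) = 0" using ker by simp
      then have "- (fiber_map es mV + fiber_map es mU) = 0"
        by (simp only: fiber_map.hom_add fiber_map.hom_uminus)
      then have "fiber_map es mV + fiber_map es mU = 0" by (simp only: neg_equal_0_iff_equal)
      then have "det M = mV - mU" using minus' d by (metis minus_add_distrib diff_conv_add_uminus)
      then show ?thesis ..
    qed (simp_all add: det)
  qed
  obtain a where a: "a \<in> C" using C by blast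
  have "image_mset pos ?U \<noteq> image_mset pos ?V"
  proof
    assume "image_mset pos ?U = image_mset pos ?V"
    then have "pos (?e a) \<in># image_mset pos ?V" using a finC by (metis (mono_tags, lifting) finite_set_mset_mset_set image_eqI set_image_mset)
    then obtain b where "b \<in> C" "pos (?e a) = pos (?f b)" using finC by auto
    then show False using disj a pos_inject eU eV by blast
  qed
  then have neq: "exps (image_mset pos ?U) \<noteq> exps (image_mset pos ?V)" by simp
  then have "mU \<noteq> mV" by (simp add: mU_def mV_def)
  then have nz: "det M \<noteq> 0" using sgn by auto
  have binI: "binomial_poly (mono u - mono v :: 'k mpol)" if "u \<noteq> v" for u v
    using that unfolding binomial_poly_def by blast
  have bin: "binomial_poly (det M)"
    using sgn binI[OF neq] binI[OF neq[symmetric]] unfolding mU_def[symmetric] mV_def[symmetric]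
    by (elim disjE) (simp_all only:)
  have "t \<le> mat_rank N"
    using minor_le_mat_rank[OF I J(1)] nz J(2) by (simp add: M_def t_def)
  moreover have "2 \<le> t"
  proof -
    have "card {a, g a} \<le> t" unfolding t_def using a gC finC by (intro card_mono) auto
    then show ?thesis using ne[OF a] by (simp add: card_insert_if split: if_splits)
  qed
  moreover have "det M \<in> bi t N"
    unfolding bi_def minors_def M_def using bin I J(1,2) by (auto simp: M_def t_def)
  ultimately have mem: "incl_T (det M) \<in> I" by (intro minor)
  have "eqv {#} ?U {#} ?V \<or> eqv {#} ?V {#} ?U"
    using sgn
  proof
    assume "det M = mV - mU"
    then show ?thesis
      using mem by (simp only: eqv_def incl_T.hom_minus mU_def mV_def incl_T_mono simp_thms)
  next
    assume "det M = mU - mV"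
    then show ?thesis
      using mem by (simp only: eqv_def incl_T.hom_minus mU_def mV_def incl_T_mono simp_thms)
  qed
  then show ?thesis using eqv_sym by blast
qed

text \<open>From a first component \<open>a\<close>, an arc of \<open>D\<close> leads to
  \<open>h a\<close>, and an arc of \<open>F\<close> with the same second component leads back to a
  first component \<open>g a\<close>. A cycle of \<open>g\<close> is exchanged by
  \<open>cycle_eqv\<close>; what remains is balanced again and smaller.\<close>

lemma arcs_eqv:
  assumes "image_mset fst D = image_mset fst F" and "image_mset snd D = image_mset snd F"
    and "\<And>p. p \<in># D \<Longrightarrow> ends p \<in> set es" and "\<And>p. p \<in># F \<Longrightarrow> ends p \<in> set es"
    and "\<And>p q. p \<in># D \<Longrightarrow> q \<in># F \<Longrightarrow> ends p \<noteq> ends q"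
  shows "eqv {#} (image_mset ends D) {#} (image_mset ends F)"
  using assms
proof (induction "size D" arbitrary: D F rule: less_induct)
  case less
  show ?case
  proof (cases "D = {#}")
    case True
    then show ?thesis using less.prems(1) by simp
  next
    case False
    let ?A = "set_mset (image_mset fst D)"
    \<comment> \<open>The arc of \<open>F\<close> exists because the second components agree, and
      \<open>g\<close> lies in \<open>?A\<close> because the first components agree.\<close>
    have "\<exists>h g. (a, h) \<in># D \<and> (g, h) \<in># F \<and> g \<in> ?A" if a: "a \<in> ?A" for a
    proof -
      obtain h where h: "(a, h) \<in># D" using a by auto
      then have "h \<in># image_mset snd D" by force
      then obtain b where "(b, h) \<in># F" unfolding less.prems(2) by auto
      moreover from this have "b \<in> ?A" unfolding less.prems(1) by force
      ultimately show ?thesis using h by blast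
    qed
    then obtain h g where hg: "\<And>a. a \<in> ?A \<Longrightarrow> (a, h a) \<in># D \<and> (g a, h a) \<in># F \<and> g a \<in> ?A"
      by metis
    have "finite ?A" "?A \<noteq> {}" "g ` ?A \<subseteq> ?A" using False hg by auto
    then obtain C where C: "C \<noteq> {}" "C \<subseteq> ?A" "g ` C = C"
      and min: "\<And>D. D \<subseteq> C \<Longrightarrow> D \<noteq> {} \<Longrightarrow> g ` D \<subseteq> D \<Longrightarrow> D = C"
      by (rule minimal_invariant_subset) blast
    have finC: "finite C" using C(2) finite_subset by blast
    have ginj: "inj_on g C" using finC C(3) by (simp add: eq_card_imp_inj_on)
    have arc: "(a, h a) \<in># D" "(g a, h a) \<in># F" if "a \<in> C" for a
      using hg[OF subsetD[OF C(2) that]] by blast+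
    define DC where "DC = {#(a, h a). a \<in># mset_set C#}"
    define FC where "FC = {#(g a, h a). a \<in># mset_set C#}"
    \<comment> \<open>The first components of the arcs in \<open>DC\<close> are distinct, and so are
      those in \<open>FC\<close> by injectivity of \<open>g\<close>. Both are thus free of
      multiplicities, and membership of their arcs is enough for containment.\<close>
    have "DC = mset_set ((\<lambda>a. (a, h a)) ` C)"
      unfolding DC_def by (rule image_mset_mset_set) (auto simp: inj_on_def)
    then have "DC \<subseteq># D" using arc by (auto intro!: mset_set_subseteqI)
    then obtain D' where D: "D = DC + D'" by (metis subset_mset.add_diff_inverse)
    have "FC = mset_set ((\<lambda>a. (g a, h a)) ` C)"
      unfolding FC_def by (rule image_mset_mset_set) (use ginj in \<open>auto simp: inj_on_def\<close>)
    then have "FC \<subseteq># F" using arc by (auto intro!: mset_set_subseteqI)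
    then obtain F' where F: "F = FC + F'" by (metis subset_mset.add_diff_inverse)
    have "image_mset fst DC = mset_set C" "image_mset fst FC = image_mset g (mset_set C)"
      "image_mset snd DC = image_mset snd FC"
      by (simp_all add: DC_def FC_def image_mset.compositionality o_def)
    moreover have "image_mset g (mset_set C) = mset_set C"
      using image_mset_mset_set[OF ginj] C(3) by simp
    ultimately have bal: "image_mset fst D' = image_mset fst F'" "image_mset snd D' = image_mset snd F'"
      using less.prems(1,2) by (simp_all add: D F)
    have "DC \<noteq> {#}" using C(1) finC by (simp add: DC_def mset_set_empty_iff)
    then have "size D' < size D" by (simp add: D nonempty_has_size)
    then have rest: "eqv {#} (image_mset ends D') {#} (image_mset ends F')"
      by (rule less.hyps[OF _ bal]) (use less.prems(3-5) in \<open>auto simp: D F\<close>)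
    have "eqv {#} {#{a, h a}. a \<in># mset_set C#} {#} {#{g a, h a}. a \<in># mset_set C#}"
    proof (rule cycle_eqv[OF C(1) _ min])
      show "bij_betw g C C" using ginj C(3) by (simp add: bij_betw_def)
      show "{a, h a} \<in> set es" if "a \<in> C" for a using less.prems(3)[OF arc(1)[OF that]] by simp
      show "{g a, h a} \<in> set es" if "a \<in> C" for a using less.prems(4)[OF arc(2)[OF that]] by simp
      show "{a, h a} \<noteq> {g b, h b}" if "a \<in> C" "b \<in> C" for a b
        using less.prems(5)[OF arc(1)[OF that(1)] arc(2)[OF that(2)]] by simp
    qed
    then have cyc: "eqv {#} (image_mset ends DC) {#} (image_mset ends FC)"
      by (simp add: DC_def FC_def image_mset.compositionality o_def)
    \<comment> \<open>The exchange is made in two stages, first with \<open>D'\<close> and then with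
      \<open>FC\<close> as the factor that stays fixed.\<close>
    have "eqv {#} (image_mset ends DC + image_mset ends D') {#} (image_mset ends FC + image_mset ends D')"
    proof -
      have "set_mset (image_mset ends D') \<subseteq> set es" using less.prems(3) by (force simp: D)
      from eqv_add[OF cyc _ this, of "{#}"] show ?thesis by simp
    qed
    moreover have "eqv {#} (image_mset ends FC + image_mset ends D') {#} (image_mset ends FC + image_mset ends F')"
    proof -
      have "set_mset (image_mset ends FC) \<subseteq> set es" using less.prems(4) by (force simp: F)
      from eqv_add[OF rest _ this, of "{#}"] show ?thesis by (simp add: ac_simps)
    qed
    ultimately show ?thesis unfolding D F image_mset_union by (rule eqv_trans)
  qed
qed

text \<open>A variable common to both monomials is divided out, and multiplying the smaller
  congruence by it gives back the original one. A Taylor step keeps both sizes, so the measure drops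
  only in the cancellation that follows it.\<close>

lemma toric_eqv:
  assumes "A + edge_sum U = B + edge_sum V" and "size U = size V"
    and "set_mset A \<subseteq> {..<n}" and "set_mset B \<subseteq> {..<n}"
    and "set_mset U \<subseteq> set es" and "set_mset V \<subseteq> set es"
  shows "eqv A U B V"
  using assms
proof (induction "size A + size U" arbitrary: A U B V rule: less_induct)
  case less
  \<comment> \<open>Stated for any \<open>A'\<close> and \<open>U'\<close> of the same sizes,
    because the monomial that shares a variable with the right-hand side may be one reached by a
    Taylor step.\<close>
  have shared: "eqv A' U' B V"
    if "A' + edge_sum U' = B + edge_sum V" "size U' = size V" "size A' = size A" "size U' = size U"
      "set_mset A' \<subseteq> {..<n}" "set_mset U' \<subseteq> set es"
      "(\<exists>i. i \<in># A' \<and> i \<in># B) \<or> (\<exists>e. e \<in># U' \<and> e \<in># V)" for A' U'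
    using that(7)
  proof (elim disjE exE conjE)
    fix i assume "i \<in># A'" "i \<in># B"
    then obtain A1 B1 where A1: "A' = add_mset i A1" and B1: "B = add_mset i B1"
      by (metis multi_member_split)
    have "size A1 + size U' < size A + size U" using that(3,4) unfolding A1 by simp
    then have "eqv A1 U' B1 V"
      by (rule less.hyps) (use that less.prems in \<open>auto simp: A1 B1\<close>)
    from eqv_add[OF this, of "{#i#}" "{#}"] show ?thesis
      using that(5) by (simp add: A1 B1)
  next
    fix e assume "e \<in># U'" "e \<in># V"
    then obtain U1 V1 where U1: "U' = add_mset e U1" and V1: "V = add_mset e V1"
      by (metis multi_member_split)
    have "size A' + size U1 < size A + size U" using that(3,4) unfolding U1 by simp
    then have "eqv A' U1 B V1"
      by (rule less.hyps) (use that less.prems in \<open>auto simp: U1 V1\<close>)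
    from eqv_add[OF this, of "{#}" "{#e#}"] show ?thesis
      using that(6) by (simp add: U1 V1)
  qed
  have cU: "card e = 2" if "e \<in># U" for e using less.prems(5) card_edge that by blast
  have cV: "card e = 2" if "e \<in># V" for e using less.prems(6) card_edge that by blast
  have "size A + 2 * size U = size B + 2 * size V"
    using arg_cong[OF less.prems(1), of size] size_edge_sum[OF cU] size_edge_sum[OF cV] by simp
  then have sAB: "size A = size B" using less.prems(2) by simp
  show ?case
  proof (cases "(\<exists>i. i \<in># A \<and> i \<in># B) \<or> (\<exists>e. e \<in># U \<and> e \<in># V)")
    case True
    then show ?thesis by (intro shared) (use less.prems in auto)
  next
    case unshared: False
    show ?thesis
    proof (cases "A = {#}")
      case True
      then have "B = {#}" using sAB by simp
      \<comment> \<open>The vertex 0 is an arbitrary choice for the two coinciding ends of the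
        trail.\<close>
      then have "add_mset 0 (edge_sum U) = add_mset 0 (edge_sum V)" using less.prems(1) True by simp
      from balanced_orientation[OF this less.prems(2) cU cV]
      obtain D F where D: "image_mset ends D = U" and F: "image_mset ends F = V"
        and bal: "image_mset fst D = image_mset fst F" "image_mset snd D = image_mset snd F" by auto
      have DU: "ends p \<in># U" if "p \<in># D" for p using that unfolding D[symmetric] by simp
      have FV: "ends p \<in># V" if "p \<in># F" for p using that unfolding F[symmetric] by simp
      have "eqv {#} (image_mset ends D) {#} (image_mset ends F)"
      proof (rule arcs_eqv[OF bal])
        show "ends p \<in> set es" if "p \<in># D" for p using DU[OF that] less.prems(5) by (rule subsetD[rotated])
        show "ends p \<in> set es" if "p \<in># F" for p using FV[OF that] less.prems(6) by (rule subsetD[rotated])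
        show "ends p \<noteq> ends q" if "p \<in># D" "q \<in># F" for p q
        proof
          assume "ends p = ends q"
          then have "ends p \<in># V" using FV[OF that(2)] by metis
          then show False using DU[OF that(1)] unshared by blast
        qed
      qed
      then show ?thesis using D F True \<open>B = {#}\<close> by simp
    next
      case False
      then obtain v0 A1 where A1: "A = add_mset v0 A1" by (metis multiset_cases)
      \<comment> \<open>As \<open>v0\<close> is not in \<open>B\<close>, it lies on an edge
        \<open>f\<close> of \<open>V\<close>. The aim is to bring \<open>f\<close> into the left
        monomial; its other vertex \<open>v1\<close> decides how.\<close>
      have "v0 \<in># B + edge_sum V" unfolding less.prems(1)[symmetric] A1 by simp
      then have "v0 \<in># edge_sum V" using unshared A1 by auto
      then obtain f V1 where V1: "V = add_mset f V1" and "v0 \<in> f" by (rule in_edge_sumE)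
      then obtain v1 where f: "f = {v0, v1}" "v0 \<noteq> v1" using cV by (metis card_2_other union_single_eq_member)
      have fes: "f \<in> set es" using V1 less.prems(6) by simp
      have "v1 \<in># A + edge_sum U" unfolding less.prems(1) V1 f by simp
      then consider "v1 \<in># A" | "v1 \<in># edge_sum U" by auto
      then obtain A' U' where step: "eqv A U A' U'" "f \<in># U'" and
        bal: "A' + edge_sum U' = A + edge_sum U" "size A' = size A" "size U' = size U" and
        carr: "set_mset A' \<subseteq> {..<n}" "set_mset U' \<subseteq> set es"
      proof cases
        \<comment> \<open>All of \<open>f\<close> divides the part in \<open>x\<close>, so any edge
          of \<open>U\<close> can be exchanged for \<open>f\<close>.\<close>
        case 1
        then have "v1 \<in># A1" using A1 f by simp
        then obtain A2 where A2: "A = mset_set f + A2" using A1 f by (auto dest!: multi_member_split)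
        have "U \<noteq> {#}" using less.prems(2) V1 by auto
        then obtain e U1 where U1: "U = add_mset e U1" by (metis multiset_cases)
        have ees: "e \<in> set es" using U1 less.prems(5) by simp
        have split: "mset_set (x - y) + mset_set (x \<inter> y) = mset_set x" if "finite x" for x y :: "nat set"
          by (rule multiset_eqI) (use that in \<open>auto simp: count_mset_set'\<close>)
        have nf: "finite e" "finite f" using fin_edge ees fes by auto
        have sube: "e \<subseteq> {..<n}" "f \<subseteq> {..<n}" using edge_bound ees fes by auto
        \<comment> \<open>Multiplying by the variables in \<open>e \<inter> f\<close> completes the
          two differences to whole edges.\<close>
        have "eqv (mset_set (f - e) + (mset_set (e \<inter> f) + A2)) ({#e#} + U1)
            (mset_set (e - f) + (mset_set (e \<inter> f) + A2)) ({#f#} + U1)"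
          using less.prems(3,5) sube nf by (intro eqv_add taylor_eqv ees fes) (auto simp: A2 U1)
        then have "eqv A U (mset_set e + A2) (add_mset f U1)"
          using split[OF nf(1), of f] split[OF nf(2), of e]
          by (simp add: A2 U1 Int_commute flip: add.assoc)
        then show thesis
          by (rule that) (use less.prems(3,5) sube nf fes cU card_edge[OF ees] card_edge[OF fes] in
              \<open>auto simp: A2 U1\<close>)
      next
        \<comment> \<open>The edges \<open>e\<close> and \<open>f\<close> meet in \<open>v1\<close>,
          so the exchange trades \<open>v0\<close> for the other end \<open>v2\<close> of
          \<open>e\<close>.\<close>
        case 2
        then obtain e U1 where U1: "U = add_mset e U1" and "v1 \<in> e" by (rule in_edge_sumE)
        then obtain v2 where e: "e = {v1, v2}" "v1 \<noteq> v2" using cU by (metis card_2_other union_single_eq_member)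
        have ees: "e \<in> set es" using U1 less.prems(5) by simp
        have "e \<noteq> f" using unshared U1 V1 by auto
        then have "v2 \<noteq> v0" using e f by auto
        then have "f - e = {v0}" "e - f = {v2}" using e f by auto
        then have "eqv {#v0#} {#e#} {#v2#} {#f#}" using taylor_eqv[OF ees fes] by simp
        then have "eqv ({#v0#} + A1) ({#e#} + U1) ({#v2#} + A1) ({#f#} + U1)"
          by (rule eqv_add) (use less.prems(3,5) in \<open>auto simp: A1 U1\<close>)
        then have "eqv A U (add_mset v2 A1) (add_mset f U1)" by (simp add: A1 U1)
        then show thesis
          by (rule that) (use less.prems(3,5) fes e f edge_bound[OF ees] in \<open>auto simp: A1 U1\<close>)
      qed
      have "eqv A' U' B V"
        by (rule shared) (use bal carr less.prems(1,2) step(2) V1 in auto)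
      then show ?thesis using step(1) eqv_trans by blast
    qed
  qed
qed

end

section \<open>From congruences of monomials to arbitrary elements of the kernel\<close>

definition mset_of_exp :: "(nat \<Rightarrow>\<^sub>0 nat) \<Rightarrow> nat multiset"
  where "mset_of_exp = inv_into UNIV exps"

lemma exps_mset_of_exp [simp]: "exps (mset_of_exp m) = m"
  unfolding mset_of_exp_def by (rule f_inv_into_f) (metis exps_surj rangeI)

lemma set_mset_of_exp [simp]: "set_mset (mset_of_exp m) = Poly_Mapping.keys m"
  using keys_exps[of "mset_of_exp m"] by simp

lemma const_const_mult_xT_mono:
  "const (const c) * xT_mono (mset_of_exp a) (mset_of_exp u) =
    Poly_Mapping.single u (Poly_Mapping.single a (c :: 'k::field))"
  by (simp add: xT_mono_def const_def mono_def mult_single)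

lemma (in edge_relations) const_in_sym: "const (const (c :: 'k)) \<in> sym_carrier n r"
proof -
  interpret base: subring_set "polys_in n UNIV :: 'k mpol set" by (rule subring_set_base)
  show ?thesis unfolding const_def by (intro single_in_polys_in) auto
qed

context edge_relations
begin

abbreviation image_exp :: "(nat \<Rightarrow>\<^sub>0 nat) \<times> (nat \<Rightarrow>\<^sub>0 nat) \<Rightarrow> nat multiset \<times> nat"
  where "image_exp x \<equiv> (mset_of_exp (snd x) + (\<Sum>i\<in>#mset_of_exp (fst x). mset_set (es ! i)), size (mset_of_exp (fst x)))"

abbreviation pair_mono :: "(nat \<Rightarrow>\<^sub>0 nat) \<times> (nat \<Rightarrow>\<^sub>0 nat) \<Rightarrow> 'k mpol mpol"
  where "pair_mono x \<equiv> xT_mono (mset_of_exp (snd x)) (mset_of_exp (fst x))"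

text \<open>The congruence of monomials with equal image is obtained for edges; passing from indices
  to edges and back by \<open>pos\<close> changes nothing on indices below \<open>r\<close>.\<close>

lemma pair_mono_diff:
  assumes "Poly_Mapping.keys (fst x) \<subseteq> {..<r}" "Poly_Mapping.keys (snd x) \<subseteq> {..<n}"
    and "Poly_Mapping.keys (fst y) \<subseteq> {..<r}" "Poly_Mapping.keys (snd y) \<subseteq> {..<n}"
    and "image_exp x = image_exp y"
  shows "pair_mono x - pair_mono y \<in> I"
proof -
  let ?E = "\<lambda>x. image_mset ((!) es) (mset_of_exp (fst x))"
  have pos: "image_mset pos (?E x) = mset_of_exp (fst x)" if "Poly_Mapping.keys (fst x) \<subseteq> {..<r}"
    for x :: "(nat \<Rightarrow>\<^sub>0 nat) \<times> (nat \<Rightarrow>\<^sub>0 nat)"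
  proof -
    have "image_mset pos (?E x) = {#pos (es ! i). i \<in># mset_of_exp (fst x)#}"
      by (simp add: image_mset.compositionality o_def)
    also have "\<dots> = {#i. i \<in># mset_of_exp (fst x)#}"
      by (rule image_mset_cong) (use that in auto)
    finally show ?thesis by simp
  qed
  have "eqv (mset_of_exp (snd x)) (?E x) (mset_of_exp (snd y)) (?E y)"
    by (rule toric_eqv)
      (use assms in \<open>auto simp: edge_sum_def image_mset.compositionality o_def\<close>)
  then show ?thesis by (simp add: eqv_def pos assms)
qed

text \<open>The terms of \<open>P\<close> are grouped by their images in the Rees algebra: in each group the
  coefficients add up to zero.\<close>

lemma kernel_subset:
  assumes P: "P \<in> sym_carrier n r" and ker: "rees_map (\<lambda>i. edge_mono (es ! i)) P = 0"
  shows "P \<in> I"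
proof -
  define K where "K = (SIGMA u:Poly_Mapping.keys P. Poly_Mapping.keys (Poly_Mapping.lookup P u))"
  define c where "c x = Poly_Mapping.lookup (Poly_Mapping.lookup P (fst x)) (snd x)" for x
  have finK: "finite K" by (simp add: K_def)
  have keysK: "Poly_Mapping.keys (fst x) \<subseteq> {..<r} \<and> Poly_Mapping.keys (snd x) \<subseteq> {..<n}" if "x \<in> K" for x
    using that P by (force simp: K_def polys_in_iff)
  let ?term = "\<lambda>x. const (const (c x)) * pair_mono x :: 'k mpol mpol"
  have single_sum: "Poly_Mapping.single u (sum f A) = (\<Sum>a\<in>A. Poly_Mapping.single u (f a))"
    for u :: "nat \<Rightarrow>\<^sub>0 nat" and f :: "(nat \<Rightarrow>\<^sub>0 nat) \<Rightarrow> 'k mpol" and A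
    by (induction A rule: infinite_finite_induct) (auto simp: single_add)
  have "P = (\<Sum>u\<in>Poly_Mapping.keys P. Poly_Mapping.single u (Poly_Mapping.lookup P u))"
    by (simp only: sum_single_lookup)
  also have "\<dots> = (\<Sum>u\<in>Poly_Mapping.keys P. \<Sum>a\<in>Poly_Mapping.keys (Poly_Mapping.lookup P u).
      Poly_Mapping.single u (Poly_Mapping.single a (Poly_Mapping.lookup (Poly_Mapping.lookup P u) a)))"
    by (simp only: single_sum[symmetric] sum_single_lookup)
  also have "\<dots> = (\<Sum>x\<in>K. ?term x)"
    by (simp add: K_def sum.Sigma const_const_mult_xT_mono c_def split_def)
  finally have Psum: "P = (\<Sum>x\<in>K. ?term x)" .
  have rees_term: "rees_map (\<lambda>i. edge_mono (es ! i)) (?term x) =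
      Polynomial.monom (Poly_Mapping.single (exps (fst (image_exp x))) (c x)) (snd (image_exp x))" for x
  proof -
    have "rees_map (\<lambda>i. edge_mono (es ! i)) (const (const (c x)) :: 'k mpol mpol) = [:const (c x):]"
      by (simp add: const_def)
    then show ?thesis
      by (simp only: rees_map.hom_mult rees_map_xT_mono)
        (simp add: smult_monom const_def mono_def mult_single)
  qed
  have zero: "(\<Sum>x\<in>{x \<in> K. image_exp x = w}. c x) = 0" for w
  proof -
    obtain m d where w: "w = (m, d)" by force
    \<comment> \<open>Each term of \<open>P\<close> maps to a single term, so the coefficient at
      \<open>x^m t^d\<close> collects exactly the group of \<open>w\<close>.\<close>
    have "0 = Poly_Mapping.lookup (Polynomial.coeff (rees_map (\<lambda>i. edge_mono (es ! i)) P) d) (exps m)"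
      by (simp add: ker)
    also have "\<dots> = (\<Sum>x\<in>K. if image_exp x = w then c x else 0)"
      unfolding Psum rees_map.hom_sum rees_term coeff_sum lookup_sum
      by (rule sum.cong) (auto simp: w lookup_single when_def simp del: exps_simps)
    also have "\<dots> = (\<Sum>x\<in>{x \<in> K. image_exp x = w}. c x)"
      using finK by (simp add: sum.inter_filter)
    finally show ?thesis by simp
  qed
  have sumI: "sum f A \<in> I" if "\<And>x. x \<in> A \<Longrightarrow> f x \<in> I" for f :: "'x \<Rightarrow> 'k mpol mpol" and A
    using that by (induction A rule: infinite_finite_induct) (auto intro: idealD(2,3))
  have group: "(\<Sum>x\<in>{x \<in> K. image_exp x = w}. ?term x) \<in> I" if w: "w \<in> image_exp ` K" for w
  proof -
    let ?L = "{x \<in> K. image_exp x = w}"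
    obtain x0 where x0: "x0 \<in> K" "image_exp x0 = w" using w by blast
    \<comment> \<open>One monomial of the group serves as reference. Subtracting it from all others
      leaves it with the sum of the coefficients as its factor, and this sum is zero.\<close>
    have "(\<Sum>x\<in>?L. ?term x) = (\<Sum>x\<in>?L. const (const (c x)) * (pair_mono x - pair_mono x0)) +
        const (const (\<Sum>x\<in>?L. c x)) * pair_mono x0"
      by (simp add: const.hom_sum sum_distrib_right right_diff_distrib sum_subtractf)
    also have "\<dots> = (\<Sum>x\<in>?L. const (const (c x)) * (pair_mono x - pair_mono x0))"
      by (simp only: zero const.hom_zero mult_zero_left add_0_right)
    also have "\<dots> \<in> I"
    proof (intro sumI idealD(4) const_in_sym pair_mono_diff)
      fix x assume "x \<in> ?L"
      then show "image_exp x = image_exp x0" using x0 by simp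
    qed (use keysK x0 in auto)
    finally show ?thesis .
  qed
  have "P = (\<Sum>w\<in>image_exp ` K. \<Sum>x\<in>{x \<in> K. image_exp x = w}. ?term x)"
    unfolding Psum by (rule sum.image_gen[OF finK])
  also have "\<dots> \<in> I" by (intro sumI group)
  finally show ?thesis .
qed

end

section \<open>The two inclusions\<close>

theorem theorem3p17:
  fixes n k :: nat and E :: "nat set set" and es :: "nat set list"
    and \<phi> :: "'k::field mpol mat" and B :: "'k mpol mpol mat" and Bbar :: "'k mpol mat"
  assumes "infinite (UNIV :: 'k set)"
    and "simple_graph n E"
    and "distinct es" and "set es = E"
    and "\<phi> = taylor_mat es"
    and "jacobian_dual n \<phi> B"
    and "Bbar = map_mat reduce B"
    and "k = mat_rank Bbar"
  shows "rees_ideal n es =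
    Idl\<^bsub>sym_ring n (length es)\<^esub>
      (elements_mat (T_row_mult \<phi>) \<union> (\<Union>t \<in> {2..k}. incl_T ` bi t Bbar))"
proof -
  let ?r = "length es" and ?p = "pairs (length es)"
  let ?gens = "elements_mat (T_row_mult \<phi>) \<union> (\<Union>t \<in> {2..k}. incl_T ` bi t Bbar)"
  have card: "card e = 2" and bound: "e \<subseteq> {..<n}" if "e \<in> set es" for e
    using assms(2,4) that by (auto simp: simple_graph_def)
  have fin: "finite e" if "e \<in> set es" for e using card[OF that] by (auto intro: card_ge_0_finite)
  have "B \<in> carrier_mat n (dim_col \<phi>)" using assms(6) by (simp add: jacobian_dual_def)
  then have B: "B \<in> carrier_mat n (length ?p)" by (simp add: assms(5) taylor_mat_def)
  then have Bbar: "Bbar \<in> carrier_mat n (length ?p)" by (simp add: assms(7))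
  have pair_lt: "fst (?p ! c) < snd (?p ! c)" "snd (?p ! c) < ?r" if "c < length ?p" for c
    using nth_mem[OF that] by (auto simp: set_pairs)
  have Bbar_nth: "Bbar $$ (i, c) = dual_entry es i (?p ! c)" if "i < n" "c < length ?p" for i c
    using reduced_dual_entry[OF fin assms(6)[unfolded assms(5)] that] B that
    by (simp add: assms(7))
  have row: "T_row_mult \<phi> \<in> carrier_mat 1 (length ?p)"
    by (rule carrier_matI) (simp_all add: T_row_mult_def assms(5) taylor_mat_def)
  define rel :: "nat \<Rightarrow> 'k mpol mpol" where "rel c =
    xT_mono (mset_set (es ! fst (?p ! c) - es ! snd (?p ! c))) {#snd (?p ! c)#} -
    xT_mono (mset_set (es ! snd (?p ! c) - es ! fst (?p ! c))) {#fst (?p ! c)#}" for c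
  have row_nth: "T_row_mult \<phi> $$ (0, c) = rel c" if "c < length ?p" for c
    unfolding assms(5) rel_def by (rule T_row_taylor[OF fin that]) auto
  have row_elems: "elements_mat (T_row_mult \<phi>) = rel ` {..<length ?p}"
    using row row_nth by (force simp: elements_mat_def)
  have "rees_ideal n es \<subseteq> Idl\<^bsub>sym_ring n ?r\<^esub> ?gens"
    \<comment> \<open>The generated ideal is the intersection of all ideals containing the
      generators, each of which can take the place of \<open>I\<close> in
      \<open>edge_relations\<close>.\<close>
    unfolding genideal_def
  proof (rule Inter_greatest)
    fix I assume "I \<in> {I. ideal I (sym_ring n ?r) \<and> ?gens \<subseteq> I}"
    then have I: "ideal I (sym_ring n ?r)" and gens: "?gens \<subseteq> I" by auto
    interpret edge_relations n es Bbar I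
    proof (rule edge_relations.intro)
      fix j k assume "j < k" "k < ?r"
      then have "(j, k) \<in> set ?p" by (simp add: set_pairs)
      then obtain c where "c < length ?p" "?p ! c = (j, k)" by (auto simp: in_set_conv_nth)
      then have "rel c \<in> I" "rel c = xT_mono (mset_set (es ! j - es ! k)) {#k#} -
          xT_mono (mset_set (es ! k - es ! j)) {#j#}"
        using gens row_elems by (auto simp: rel_def)
      then show "xT_mono (mset_set (es ! j - es ! k)) {#k#} - xT_mono (mset_set (es ! k - es ! j)) {#j#} \<in> I"
        by simp
    next
      fix t p assume "2 \<le> t" "t \<le> mat_rank Bbar" "p \<in> bi t Bbar"
      then show "incl_T p \<in> I" using gens assms(8) by force
    qed (use card bound assms(3) I Bbar Bbar_nth in auto)
    show "rees_ideal n es \<subseteq> I" using kernel_subset by (auto simp: rees_ideal_eq)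
  qed
  moreover have "Idl\<^bsub>sym_ring n ?r\<^esub> ?gens \<subseteq> rees_ideal n es"
  proof -
    interpret sym: subring_set "sym_carrier n ?r :: 'k mpol mpol set" by (rule subring_set_sym)
    interpret T: subring_set "polys_in ?r UNIV :: 'k mpol set"
      by (intro subring_set_polys_in subring_set_UNIV)
    interpret ring "sym_ring n ?r :: 'k mpol mpol ring"
      unfolding sym_ring_def by (rule sym.ring_ring_on)
    have "rel c \<in> rees_ideal n es" if c: "c < length ?p" for c
    proof -
      obtain j k where jk: "?p ! c = (j, k)" by force
      then have "j < ?r" "k < ?r" using pair_lt[OF c] by auto
      then have es: "es ! j \<in> set es" "es ! k \<in> set es" by auto
      have "mset_set (es ! j - es ! k) + mset_set (es ! k) = mset_set (es ! k - es ! j) + mset_set (es ! j)"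
        by (rule multiset_eqI) (use fin[OF es(1)] fin[OF es(2)] in \<open>auto simp: count_mset_set'\<close>)
      then have "rees_map (\<lambda>i. edge_mono (es ! i)) (rel c) = 0"
        by (simp add: rel_def jk rees_map.hom_minus rees_map_xT_mono del: exps_simps)
      moreover have "rel c \<in> sym_carrier n ?r"
        unfolding rel_def jk using bound[OF es(1)] bound[OF es(2)] fin[OF es(1)] fin[OF es(2)] \<open>j < ?r\<close> \<open>k < ?r\<close>
        by (intro sym.diff xT_mono_in_sym) auto
      ultimately show ?thesis by (simp add: rees_ideal_eq)
    qed
    moreover have "incl_T p \<in> rees_ideal n es" if "p \<in> bi t Bbar" for t p
    proof -
      obtain I J where IJ: "I \<subseteq> {..<dim_row Bbar}" "J \<subseteq> {..<dim_col Bbar}" "card I = t" "card J = t"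
        and p: "p = det (submatrix Bbar I J)" and bin: "binomial_poly p"
        using \<open>p \<in> bi t Bbar\<close> by (auto simp: bi_def minors_def)
      have M: "submatrix Bbar I J \<in> carrier_mat t t" using submatrix_carrier[OF IJ(1,2)] IJ by simp
      have rho: "bij_betw (pick I) {0..<t} I"
        using bij_betw_pick[of I] finite_subset[OF IJ(1)] IJ(3) by simp
      have pickI: "pick I i < n" if "i < t" for i
        using bij_betwE[OF rho] that IJ(1) Bbar by auto
      have pickJ: "pick J j < length ?p" if "j < t" for j
        using pick_in_set_le[of j J] that IJ(2,4) Bbar by auto
      have entries: "submatrix Bbar I J $$ (i, j) = dual_entry es (pick I i) (?p ! pick J j)"
        if "i < t" "j < t" for i j
        using submatrix_nth[OF IJ(1,2)] that IJ(3,4) Bbar_nth[OF pickI pickJ] by simp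
      have "fiber_map es p = 0 \<or> (\<exists>w. p = mono w \<or> p = - mono w)"
        unfolding p
      proof (rule fiber_map_det_or_mono[OF M _ entries card])
        show "inj_on (pick I) {..<t}" using rho by (simp add: bij_betw_def lessThan_atLeast0)
        show "fst (?p ! pick J j) < ?r \<and> snd (?p ! pick J j) < ?r" if "j < t" for j
          using pair_lt[OF pickJ[OF that]] by simp
      qed
      then have "fiber_map es p = 0" using binomial_poly_not_mono[OF bin] by blast
      \<comment> \<open>Membership in the defining ideal also requires that the minor involve no
        \<open>T\<close> variable with an index beyond the number of edges; this is inherited from
        the entries.\<close>
      moreover have "var j \<in> polys_in ?r (UNIV :: 'k set)" if "j < ?r" for j
        unfolding var_def mono_def by (rule single_in_polys_in) (use that in auto)
      then have "dual_entry es i (?p ! c) \<in> polys_in ?r (UNIV :: 'k set)" if "c < length ?p" for i c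
        unfolding dual_entry_def using pair_lt[OF that] by (intro T.diff) auto
      then have "p \<in> polys_in ?r UNIV"
        unfolding p by (intro T.det[OF M]) (simp add: entries pickJ)
      then have "incl_T p \<in> sym_carrier n ?r" by (rule incl_T_in_sym)
      ultimately show ?thesis by (simp add: rees_ideal_eq fiber_map_def)
    qed
    ultimately have "?gens \<subseteq> rees_ideal n es" unfolding row_elems by auto
    then show ?thesis by (intro genideal_minimal ideal_rees_ideal)
  qed
  ultimately show ?thesis by (rule subset_antisym)
qed

end
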